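(* Let $d\in\mathbb N$ and let $u:\mathbb R^d\to\mathbb R$ have subdifferential $\partial u$. Assume: (A1) there is $L\ge0$ such that $u+\frac L2|\cdot|^2$ is convex; (A2) there are $\mu>0$, $R\ge 0$ such that every selection $h$ of $\partial u$ satisfies $\langle h(x)-h(y),x-y\rangle\ge\mu|x-y|^2$ for all $x,y\in\mathbb R^d$ with $|x-y|\ge R$; (A3) there are $m,K>0$ and $p\ge1$ such that every selection $h$ of $\partial u$ satisfies $|h(x)|\le m+K|x|^p$ for all $x\in\mathbb R^d$; (A4) $\theta_0$ is an $\mathbb R^d$-valued random variable with $\mathbb E|\theta_0|^{2p}<\infty$. Fix a measurable selection $h$ of $\partial u$ and let $\lambda_0\in(0,1/(4\mu))$. Let $\theta^*$ be a minimiser of $u$, put $b=\max\{m^2/(2\mu),mR+(L+\mu/2)R^2\}$ and $$J=m+K2^{2p-2}\big(1+(2b/\mu)^{p/2}\big)+\frac{K2^{p-1}}{p+1}.$$ Then for every $\lambda\in(0,\lambda_0)$, $n\in\mathbb N$ and $\beta\ge\max\{4/\mu,1/J\}$, with $\pi_\beta(dx)\propto e^{-\beta u(x)}dx$ and $\theta_n^\lambda$ the iterates of SG-TULA, $$\mathbb E[u(\theta_n^\lambda)]-u(\theta^* )\le C_{\mathcal T_1}W_2\big(\pi_\beta,\mathcal L(\theta_n^\lambda)\big)+\frac{d}{2\beta}\log\Big(\frac{2(b+d/\beta)\beta^2J^2}{\mu}\Big)+\frac1{2\beta}\log(\pi d)+\frac{13}{6\beta},$$ where $C_{\mathcal T_1}$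 is the explicit constant given in the context.
   Context: Subdifferential of an $L$-semi-convex $u$: $\partial u(x)=\{g: u(y)\ge u(x)+\langle g,y-x\rangle-\frac L2|y-x|^2\ \forall y\}$; a selection is a map $h$ with $h(x)\in\partial u(x)$ for all $x$. $W_2$ is the Wasserstein distance of order 2, $\mathcal L(X)$ the law of $X$. In $\log(\pi d)$, $\pi$ is the number $3.14\ldots$ SG-TULA (uniform taming) with stepsize $\lambda>0$: $\theta_{n+1}^{\lambda}=\theta_n^{\lambda}-\lambda h_\lambda(\theta_n^{\lambda})+\sqrt{2\lambda\beta^{-1}}\,\xi_{n+1}$, $\theta_0^{\lambda}=\theta_0$, $(\xi_n)_{n\ge1}$ i.i.d. standard Gaussian on $\mathbb R^d$ independent of $\theta_0$, $h_\lambda(x)=\frac{h(x)-\mu x}{1+\lambda^{1/2}|h(x)-\mu x|}+\mu x$. Constants: $A(q)=1+2\big(b+\beta^{-1}(d+(q-2)^+)\big)/\mu$; $D_p=(2p-1)!!$ (read as $2^p\Gamma(p+\frac12)/\sqrt\pi$ for non-integer $p$), $\Lambda_p=p(p+1)2^{3p-3}\sqrt{D_p}$, $M(p)=2^{3p+1}\Lambda_p^{\,p}$; $C_{B_2}=\mathbb E|\theta_0|^{2p}+M(p)\mu^{-p}(1+b+d\beta^{-1})^p$; and $C_{\mathcal T_1}=m+\frac{2^{p-1}K}{p+1}\big(\sqrt{C_{B_2}}+A(2p)^{p/2}\big)$. *)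

theory Defs
  imports "HOL-Probability.Probability"
begin

definition subdifferential :: "real \<Rightarrow> ('a::real_inner \<Rightarrow> real) \<Rightarrow> 'a \<Rightarrow> 'a set"
  where "subdifferential L u x =
    {g. \<forall>y. u y \<ge> u x + g \<bullet> (y - x) - L / 2 * (norm (y - x))\<^sup>2}"

definition is_selection :: "real \<Rightarrow> ('a::real_inner \<Rightarrow> real) \<Rightarrow> ('a \<Rightarrow> 'a) \<Rightarrow> bool"
  where "is_selection L u h \<longleftrightarrow> (\<forall>x. h x \<in> subdifferential L u x)"

definition couplings :: "'a::metric_space measure \<Rightarrow> 'a measure \<Rightarrow> ('a \<times> 'a) measure set"
  where "couplings P Q =
    {C. prob_space C \<and> sets C = sets (borel \<Otimes>\<^sub>M borel) \<and>
        distr C borel fst = P \<and> distr C borel snd = Q}"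

(* The infimum is taken in the extended reals. It is finite when P and Q are probability measures
   on a Euclidean space with finite second moments, the setting in which W2 is a metric. *)
definition wasserstein2 :: "'a::metric_space measure \<Rightarrow> 'a measure \<Rightarrow> real"
  where "wasserstein2 P Q =
    sqrt (enn2real (INF C\<in>couplings P Q. \<integral>\<^sup>+ z. ennreal ((dist (fst z) (snd z))\<^sup>2) \<partial>C))"

definition gibbs :: "real \<Rightarrow> ('a::euclidean_space \<Rightarrow> real) \<Rightarrow> 'a measure"
  where "gibbs \<beta> u = density lborel
    (\<lambda>x. ennreal (exp (- \<beta> * u x)) / (\<integral>\<^sup>+ y. ennreal (exp (- \<beta> * u y)) \<partial>lborel))"

definition std_gaussian_density :: "real ^ 'd \<Rightarrow> real"
  where "std_gaussian_density x = (\<Prod>i\<in>UNIV. std_normal_density (x $ i))"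

definition tamed_drift ::
    "('a::real_normed_vector \<Rightarrow> 'a) \<Rightarrow> real \<Rightarrow> real \<Rightarrow> 'a \<Rightarrow> 'a"
  where "tamed_drift h \<mu> l x =
    (h x - \<mu> *\<^sub>R x) /\<^sub>R (1 + sqrt l * norm (h x - \<mu> *\<^sub>R x)) + \<mu> *\<^sub>R x"

primrec sg_tula ::
    "('a::real_normed_vector \<Rightarrow> 'a) \<Rightarrow> real \<Rightarrow> real \<Rightarrow> real \<Rightarrow> ('w \<Rightarrow> 'a) \<Rightarrow> (nat \<Rightarrow> 'w \<Rightarrow> 'a)
      \<Rightarrow> nat \<Rightarrow> 'w \<Rightarrow> 'a"
  where
    "sg_tula h \<mu> \<beta> l \<theta>0 \<xi> 0 \<omega> = \<theta>0 \<omega>"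
  | "sg_tula h \<mu> \<beta> l \<theta>0 \<xi> (Suc n) \<omega> =
       sg_tula h \<mu> \<beta> l \<theta>0 \<xi> n \<omega> - l *\<^sub>R tamed_drift h \<mu> l (sg_tula h \<mu> \<beta> l \<theta>0 \<xi> n \<omega>)
         + sqrt (2 * l / \<beta>) *\<^sub>R \<xi> (Suc n) \<omega>"

definition moment_const :: "real \<Rightarrow> real \<Rightarrow> real \<Rightarrow> real \<Rightarrow> real \<Rightarrow> real"
  where "moment_const \<mu> b \<beta> d q = 1 + 2 * (b + (d + max 0 (q - 2)) / \<beta>) / \<mu>"

(* The double factorial (2p - 1)!!, extended to real p. *)
definition odd_fact :: "real \<Rightarrow> real"
  where "odd_fact p = 2 powr p * Gamma (p + 1 / 2) / sqrt pi"

lemma odd_fact_nat: "odd_fact (real n) = (\<Prod>k=1..n. real (2 * k - 1))"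
proof (induction n)
  case 0
  then show ?case by (simp add: odd_fact_def Gamma_one_half_real)
next
  case (Suc n)
  have "Gamma (real n + 1 / 2 + 1) = (real n + 1 / 2) * Gamma (real n + 1 / 2)"
    by (rule Gamma_plus1) (auto simp: nonpos_Ints_def)
  moreover have "real (Suc n) + 1 / 2 = real n + 1 / 2 + 1" by simp
  ultimately have "odd_fact (real (Suc n)) = (2 * real n + 1) * odd_fact (real n)"
    by (simp add: odd_fact_def powr_add algebra_simps)
  then show ?case using Suc by (simp add: algebra_simps)
qed

definition Lambda_const :: "real \<Rightarrow> real"
  where "Lambda_const p = p * (p + 1) * 2 powr (3 * p - 3) * sqrt (odd_fact p)"

definition M_const :: "real \<Rightarrow> real"
  where "M_const p = 2 powr (3 * p + 1) * Lambda_const p powr p"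

(* The argument E is the moment of order 2p of the initial value. *)
definition CB2 :: "real \<Rightarrow> real \<Rightarrow> real \<Rightarrow> real \<Rightarrow> real \<Rightarrow> real \<Rightarrow> real"
  where "CB2 E p \<mu> b \<beta> d = E + M_const p * \<mu> powr (- p) * (1 + b + d / \<beta>) powr p"

definition CT1 ::
    "real \<Rightarrow> real \<Rightarrow> real \<Rightarrow> real \<Rightarrow> real \<Rightarrow> real \<Rightarrow> real \<Rightarrow> real \<Rightarrow> real"
  where "CT1 E m K p \<mu> b \<beta> d =
    m + 2 powr (p - 1) * K / (p + 1)
      * (sqrt (CB2 E p \<mu> b \<beta> d) + moment_const \<mu> b \<beta> d (2 * p) powr (p / 2))"

end

theory Submission
  imports Defs
begin

text \<open>
  The excess risk splits into the change of the expectation of \<open>u\<close> from the Gibbs measure to the law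
  of the iterate, and the excess risk of the Gibbs measure.

  For the first part, integrating the growth condition along a segment bounds the increment of \<open>u\<close> by
  \<open>|x - y| (m + k (|x|\<^sup>p + |y|\<^sup>p))\<close>; under any coupling the Cauchy-Schwarz inequality turns this into the
  coupling cost times moments of order \<open>2p\<close> of both laws. Dissipativity
  \<open>\<langle>h x, x\<rangle> \<ge> \<mu> |x|\<^sup>2 / 2 - b\<close> bounds these moments, for the Gibbs measure through invariance of Lebesgue
  measure under scaling. The chain contracts because the taming keeps
  \<open>|x - \<lambda> h\<^sub>\<lambda>(x)|\<^sup>2 \<le> (1 - \<lambda>\<mu>/2) |x|\<^sup>2 + 2\<lambda>(b + 1)\<close>, the Gaussian noise adds a multiple of \<open>\<lambda>/\<beta>\<close>
  inside the power, and \<open>t\<^sup>p\<close> is convex.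

  For the second part, \<open>\<beta>\<close> times the Gibbs expectation of \<open>u\<close> is the differential entropy minus the log
  of the partition function. The entropy is at most that of a Gaussian with the same second moment, and
  the partition function is bounded from below on the ball of radius \<open>1/(\<beta>J)\<close> around the minimiser.
\<close>

text \<open>The potential is merely semi-convex and \<open>p\<close> is real, so gradients,
  integration by parts and binomial expansions are out of reach. Increments, radial growth and Gibbs
  moments all come from the subgradient inequality between two nearby points, whose quadratic error
  vanishes in the limit; powers enter through convexity alone. The growth and monotonicity
  hypotheses range over all selections. This matters at the minimiser, where the given
  \<open>h\<close> may be nonzero: a selection changed to 0 there bounds the norm of the minimiser,
  and this bound is what \<open>J\<close> contains. In the last constant 13/6 = 1 + 7/6. The 1 is
  the rise of \<open>\<beta> * u\<close> on the ball around the minimiser and 7/6 is the slack of a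
  Stirling bound; the terms in n, n ln pi and n ln (n / 2) cancel between the Gaussian entropy and
  the volume of the ball.\<close>

section \<open>Increments of semi-convex functions\<close>

lemma powr_above_tangent:
  fixes a b p :: real
  assumes "a \<ge> 0" "b \<ge> 0" "p \<ge> 1"
  shows "b powr p + p * b powr (p - 1) * (a - b) \<le> a powr p"
\<comment> \<open>The tangent argument lives on the open half-line. At the boundary 0 powr anything
  is 0, also for exponent 0, so for \<open>b = 0\<close> the left side vanishes even when
  \<open>p = 1\<close>.\<close>
proof (cases "a = 0 \<or> b = 0")
  case True
  show ?thesis
  proof (cases "b = 0")
    case False
    with True assms have "a = 0" "b powr (p - 1) * b = b powr p"
      using powr_add[of b "p - 1" 1] by auto
    then have "b powr p + p * b powr (p - 1) * (a - b) = (1 - p) * b powr p"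
      by (simp add: algebra_simps)
    then show ?thesis using assms \<open>a = 0\<close> by (simp add: mult_nonpos_nonneg)
  qed (use assms in auto)
next
  case False
  then have "a > 0" "b > 0" using assms by auto
  have "p * b powr (p - 1) * (a - b) \<le> a powr p - b powr p"
    using \<open>a > 0\<close> \<open>b > 0\<close> assms
    by (intro convex_on_imp_above_tangent[where A = "{0<..}"] powr_convex)
       (auto intro!: derivative_eq_intros simp: interior_open)
  then show ?thesis by simp
qed

lemma powr_convex_combination:
  fixes a b p t :: real
  assumes "a \<ge> 0" "b \<ge> 0" "p \<ge> 1" "0 \<le> t" "t \<le> 1"
  shows "((1 - t) * a + t * b) powr p \<le> (1 - t) * a powr p + t * b powr p"
proof -
  define z where "z = (1 - t) * a + t * b"
  have "z \<ge> 0" using assms by (simp add: z_def)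
  have "(1 - t) * (z powr p + p * z powr (p - 1) * (a - z)) + t * (z powr p + p * z powr (p - 1) * (b - z))
     \<le> (1 - t) * a powr p + t * b powr p"
    using assms \<open>z \<ge> 0\<close> by (intro add_mono mult_left_mono powr_above_tangent) auto
  also have "(1 - t) * (z powr p + p * z powr (p - 1) * (a - z)) + t * (z powr p + p * z powr (p - 1) * (b - z))
     = z powr p + p * z powr (p - 1) * ((1 - t) * a + t * b - z)"
    by (simp add: algebra_simps)
  finally show ?thesis by (simp add: z_def)
qed

lemma powr_add_le:
  fixes a b p :: real
  assumes "a \<ge> 0" "b \<ge> 0" "p \<ge> 1"
  shows "(a + b) powr p \<le> 2 powr (p - 1) * (a powr p + b powr p)"
proof -
  have "(a + b) powr p = 2 powr p * ((1 - 1/2) * a + 1/2 * b) powr p"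
    using assms by (simp flip: powr_mult add: algebra_simps)
  also have "\<dots> \<le> 2 powr p * ((1 - 1/2) * a powr p + 1/2 * b powr p)"
    using assms by (intro mult_left_mono powr_convex_combination) auto
  also have "\<dots> = 2 powr (p - 1) * (a powr p + b powr p)"
    by (simp add: powr_diff algebra_simps)
  finally show ?thesis .
qed

text \<open>The tangent at the right end has slope at most \<open>p\<close> on the unit interval.
  This measures the loss when an increasing power is evaluated at the right end of a short
  interval.\<close>

lemma powr_diff_le_unit_interval:
  fixes s t p :: real
  assumes "0 \<le> s" "s \<le> t" "t \<le> 1" "p \<ge> 1"
  shows "t powr p - s powr p \<le> p * (t - s)"
proof -
  have "t powr p + p * t powr (p - 1) * (s - t) \<le> s powr p"
    using assms by (intro powr_above_tangent) auto
  then have "t powr p - s powr p \<le> p * (t - s) * t powr (p - 1)" by (simp add: algebra_simps)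
  also have "\<dots> \<le> p * (t - s) * 1"
    using assms by (intro mult_left_mono) (auto simp: powr_le1)
  finally show ?thesis by simp
qed

text \<open>Replaces the fundamental theorem of calculus along segments: a semi-convex function need not
  be differentiable, but its subgradient inequalities determine increments up to quadratic errors,
  which vanish under subdivision.\<close>

lemma le_of_quadratic_defect:
  fixes f :: "real \<Rightarrow> real"
  assumes "a \<le> b" and f: "\<And>s t. a \<le> s \<Longrightarrow> s \<le> t \<Longrightarrow> t \<le> b \<Longrightarrow> f t - f s \<ge> - C * (t - s)\<^sup>2"
  shows "f a \<le> f b"
proof -
  have step: "f b - f a \<ge> - C * (b - a)\<^sup>2 / real (Suc N)" for N
  proof -
    define z where "z k = a + real k * ((b - a) / real (Suc N))" for k
    have "f b - f a = (\<Sum>k<Suc N. f (z (Suc k)) - f (z k))"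
      by (subst sum_lessThan_telescope) (simp add: z_def)
    also have "\<dots> \<ge> (\<Sum>k<Suc N. - C * ((b - a) / real (Suc N))\<^sup>2)"
    proof (rule sum_mono)
      fix k assume k: "k \<in> {..<Suc N}"
      have "real (Suc k) * ((b - a) / real (Suc N)) \<le> real (Suc N) * ((b - a) / real (Suc N))"
        using k \<open>a \<le> b\<close> by (intro mult_right_mono) auto
      then have "z (Suc k) \<le> b" by (simp add: z_def)
      moreover have "z (Suc k) - z k = (b - a) / real (Suc N)"
        by (simp add: z_def distrib_right del: times_divide_eq_right)
      moreover have "a \<le> z k" "z k \<le> z (Suc k)"
        using \<open>a \<le> b\<close> by (auto simp: z_def intro!: divide_right_mono mult_right_mono)
      ultimately show "- C * ((b - a) / real (Suc N))\<^sup>2 \<le> f (z (Suc k)) - f (z k)"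
        using f[of "z k" "z (Suc k)"] by simp
    qed
    moreover have "(\<Sum>k<Suc N. - C * ((b - a) / real (Suc N))\<^sup>2) = - C * (b - a)\<^sup>2 / real (Suc N)"
      by (simp add: power2_eq_square field_simps del: of_nat_Suc)
    ultimately show ?thesis by linarith
  qed
  have "(\<lambda>N. - C * (b - a)\<^sup>2 / real (Suc N)) \<longlonglongrightarrow> 0"
    using LIMSEQ_Suc[OF lim_const_over_n] by blast
  then have "0 \<le> f b - f a"
    by (rule LIMSEQ_le_const2) (use step in auto)
  then show ?thesis by simp
qed

lemma is_selectionD:
  assumes "is_selection L u h"
  shows "u x + h x \<bullet> (y - x) - L / 2 * (norm (y - x))\<^sup>2 \<le> u y"
  using assms by (auto simp: is_selection_def subdifferential_def)

text \<open>A mean value inequality: the right side is the length of the segment times the integral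
  of the assumed bound, each power contributing 1 / (p + 1). The two weights keep the influence of
  the two endpoints apart; \<open>\<gamma> = 0\<close> leaves only growth away from
  \<open>y\<close>.\<close>

lemma segment_increment_bound:
  fixes u :: "'a::real_inner \<Rightarrow> real"
  assumes sel: "is_selection L u h" and "L \<ge> 0" "p \<ge> 1" "\<gamma> \<ge> 0" "\<delta> \<ge> 0"
    and h: "\<And>t. 0 \<le> t \<Longrightarrow> t \<le> 1 \<Longrightarrow>
      norm (h (y + t *\<^sub>R (x - y))) \<le> \<alpha> + \<gamma> * (1 - t) powr p + \<delta> * t powr p"
  shows "u x - u y \<le> norm (x - y) * (\<alpha> + (\<gamma> + \<delta>) / (p + 1))"
proof -
  define z where "z t = y + t *\<^sub>R (x - y)" for t
  define D where "D = norm (x - y)"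
  \<comment> \<open>Up to a constant, the antiderivative of \<open>D\<close> times the bound. It
    remains to see that \<open>G t - u (z t)\<close> does not decrease.\<close>
  define G where "G t = D * (\<alpha> * t + (\<delta> * t powr (p + 1) - \<gamma> * (1 - t) powr (p + 1)) / (p + 1))" for t
  have "G 0 - u (z 0) \<le> G 1 - u (z 1)"
  proof (rule le_of_quadratic_defect[where C = "D * \<delta> * p + L / 2 * D\<^sup>2"
        and f = "\<lambda>t. G t - u (z t)"])
    fix s t :: real assume st: "0 \<le> s" "s \<le> t" "t \<le> 1"
    have diff: "z s - z t = - ((t - s) *\<^sub>R (x - y))" by (simp add: z_def algebra_simps)
    \<comment> \<open>An upper bound for the increment needs the subgradient at the later point
      \<open>z t\<close>.\<close>
    have "u (z t) - u (z s) \<le> - (h (z t) \<bullet> (z s - z t)) + L / 2 * (norm (z s - z t))\<^sup>2"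
      using is_selectionD[OF sel, of "z t" "z s"] by simp
    also have "- (h (z t) \<bullet> (z s - z t)) \<le> norm (h (z t)) * norm (z s - z t)"
      using Cauchy_Schwarz_ineq2[of "h (z t)" "z s - z t"] by simp
    also have "norm (z s - z t) = (t - s) * D" using st by (simp add: diff D_def)
    also have "norm (h (z t)) * ((t - s) * D) \<le>
       (\<alpha> + \<gamma> * (1 - t) powr p + \<delta> * t powr p) * ((t - s) * D)"
      using st h[of t] by (intro mult_right_mono) (auto simp: z_def D_def)
    finally have 1: "u (z t) - u (z s) \<le>
       (t - s) * D * (\<alpha> + \<gamma> * (1 - t) powr p + \<delta> * t powr p) + L / 2 * D\<^sup>2 * (t - s)\<^sup>2"
      by (simp only: power_mult_distrib mult_ac)
    \<comment> \<open>The integrand \<open>t powr p\<close> increases, so its value at the later end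
      exceeds the mean; the excess is at most p (t - s) and goes into the quadratic defect. The
      integrand in \<open>1 - t\<close> decreases and costs nothing.\<close>
    have "s powr (p + 1) + (p + 1) * s powr p * (t - s) \<le> t powr (p + 1)"
      using powr_above_tangent[of t s "p + 1"] st assms(3) by simp
    moreover have "(p + 1) * (t - s) * (t powr p - p * (t - s)) \<le> (p + 1) * (t - s) * s powr p"
      using powr_diff_le_unit_interval[of s t p] st assms(3) by (intro mult_left_mono) auto
    ultimately have "(p + 1) * (t - s) * (t powr p - p * (t - s)) \<le> t powr (p + 1) - s powr (p + 1)"
      by (simp add: algebra_simps)
    then have 2: "(t - s) * (t powr p - p * (t - s)) \<le> (t powr (p + 1) - s powr (p + 1)) / (p + 1)"
      using assms(3) by (simp add: field_simps)
    have "(1 - t) powr (p + 1) + (p + 1) * (1 - t) powr p * (t - s) \<le> (1 - s) powr (p + 1)"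
      using powr_above_tangent[of "1 - s" "1 - t" "p + 1"] st assms(3) by simp
    then have 3: "(t - s) * (1 - t) powr p \<le> ((1 - s) powr (p + 1) - (1 - t) powr (p + 1)) / (p + 1)"
      using assms(3) by (simp add: field_simps)
    have "G t - G s = D * (\<alpha> * (t - s) + \<delta> * ((t powr (p + 1) - s powr (p + 1)) / (p + 1))
        + \<gamma> * (((1 - s) powr (p + 1) - (1 - t) powr (p + 1)) / (p + 1)))"
      using assms(3) by (simp add: G_def field_simps)
    also have "\<dots> \<ge> D * (\<alpha> * (t - s) + \<delta> * ((t - s) * (t powr p - p * (t - s)))
        + \<gamma> * ((t - s) * (1 - t) powr p))"
      using 2 3 assms by (intro mult_left_mono add_mono order_refl) (auto simp: D_def)
    finally have "G t - G s \<ge> (t - s) * D * (\<alpha> + \<gamma> * (1 - t) powr p + \<delta> * t powr p) - D * \<delta> * p * (t - s)\<^sup>2"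
      by (simp add: algebra_simps power2_eq_square)
    with 1 show "- (D * \<delta> * p + L / 2 * D\<^sup>2) * (t - s)\<^sup>2 \<le> G t - u (z t) - (G s - u (z s))"
      by (simp add: algebra_simps)
  qed simp
  then have "u x - u y \<le> G 1 - G 0" by (simp add: z_def)
  also have "\<dots> = D * (\<alpha> + (\<gamma> + \<delta>) / (p + 1))"
    by (simp add: G_def add_divide_distrib algebra_simps)
  finally show ?thesis by (simp add: D_def)
qed

text \<open>Splitting the norm on the segment by \<open>powr_add_le\<close> leaves the weights t
  powr p and (1 - t) powr p. Their integrals 1 / (p + 1) are the origin of the factor before the
  moments in \<open>CT1\<close>.\<close>

lemma growth_increment_bound:
  fixes u :: "'a::real_inner \<Rightarrow> real"
  assumes sel: "is_selection L u h" and "L \<ge> 0" "p \<ge> 1" "K \<ge> 0"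
    and h: "\<And>x. norm (h x) \<le> m + K * norm x powr p"
  shows "u x - u y \<le>
    norm (x - y) * (m + 2 powr (p - 1) * K / (p + 1) * (norm x powr p + norm y powr p))"
proof -
  have "u x - u y \<le> norm (x - y) *
    (m + (2 powr (p - 1) * K * norm y powr p + 2 powr (p - 1) * K * norm x powr p) / (p + 1))"
  proof (rule segment_increment_bound[OF sel \<open>L \<ge> 0\<close> \<open>p \<ge> 1\<close>])
    fix t :: real assume t: "0 \<le> t" "t \<le> 1"
    have eq: "y + t *\<^sub>R (x - y) = (1 - t) *\<^sub>R y + t *\<^sub>R x" by (simp add: algebra_simps)
    have "norm (y + t *\<^sub>R (x - y)) \<le> (1 - t) * norm y + t * norm x"
      unfolding eq using norm_triangle_ineq[of "(1 - t) *\<^sub>R y" "t *\<^sub>R x"] t by simp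
    then have "norm (y + t *\<^sub>R (x - y)) powr p \<le> ((1 - t) * norm y + t * norm x) powr p"
      using assms by (intro powr_mono2) auto
    also have "\<dots> \<le> 2 powr (p - 1) * (((1 - t) * norm y) powr p + (t * norm x) powr p)"
      using assms t by (intro powr_add_le) auto
    also have "\<dots> = 2 powr (p - 1) * ((1 - t) powr p * norm y powr p + t powr p * norm x powr p)"
      using t by (simp add: powr_mult)
    finally have "K * norm (y + t *\<^sub>R (x - y)) powr p \<le>
       K * (2 powr (p - 1) * ((1 - t) powr p * norm y powr p + t powr p * norm x powr p))"
      using \<open>K \<ge> 0\<close> by (rule mult_left_mono)
    with h[of "y + t *\<^sub>R (x - y)"] show "norm (h (y + t *\<^sub>R (x - y))) \<le>
       m + 2 powr (p - 1) * K * norm y powr p * (1 - t) powr p + 2 powr (p - 1) * K * norm x powr p * t powr p"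
      by (simp add: algebra_simps)
  qed (use assms in auto)
  then show ?thesis by (simp add: algebra_simps add_divide_distrib)
qed

text \<open>Within distance 1 the norm of \<open>x\<close> can be avoided, since a point of the
  segment has norm at most \<open>norm y + t\<close>. At the minimiser this leads to
  \<open>J\<close>.\<close>

lemma local_increment_bound:
  fixes u :: "'a::real_inner \<Rightarrow> real"
  assumes sel: "is_selection L u h" and "L \<ge> 0" "p \<ge> 1" "K \<ge> 0"
    and h: "\<And>x. norm (h x) \<le> m + K * norm x powr p"
    and "norm (x - y) \<le> 1"
  shows "u x - u y \<le>
    norm (x - y) * (m + K * 2 powr (p - 1) * norm y powr p + K * 2 powr (p - 1) / (p + 1))"
proof -
  have "u x - u y \<le> norm (x - y) *
    ((m + K * 2 powr (p - 1) * norm y powr p) + (0 + K * 2 powr (p - 1)) / (p + 1))"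
  proof (rule segment_increment_bound[OF sel \<open>L \<ge> 0\<close> \<open>p \<ge> 1\<close>])
    fix t :: real assume t: "0 \<le> t" "t \<le> 1"
    have "t * norm (x - y) \<le> t" using assms(6) t by (simp add: mult_left_le)
    then have "norm (y + t *\<^sub>R (x - y)) \<le> norm y + t"
      using norm_triangle_ineq[of y "t *\<^sub>R (x - y)"] t by simp
    then have "norm (y + t *\<^sub>R (x - y)) powr p \<le> (norm y + t) powr p"
      using assms by (intro powr_mono2) auto
    also have "\<dots> \<le> 2 powr (p - 1) * (norm y powr p + t powr p)"
      using assms t by (intro powr_add_le) auto
    finally have "K * norm (y + t *\<^sub>R (x - y)) powr p \<le> K * (2 powr (p - 1) * (norm y powr p + t powr p))"
      using \<open>K \<ge> 0\<close> by (rule mult_left_mono)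
    with h[of "y + t *\<^sub>R (x - y)"] show "norm (h (y + t *\<^sub>R (x - y))) \<le>
       m + K * 2 powr (p - 1) * norm y powr p + 0 * (1 - t) powr p + K * 2 powr (p - 1) * t powr p"
      by (simp add: algebra_simps)
  qed (use assms in auto)
  then show ?thesis by simp
qed

section \<open>Moments of Gibbs weights\<close>

text \<open>All negative numbers are included because the exponents to which it is applied are
  bounded only from above. There exp z is at most 1 / (1 - z), and (1 + z + z^2) (1 - z) = 1 - z^3
  is at least 1.\<close>

lemma exp_le_quadratic:
  fixes z :: real
  assumes "z \<le> 1"
  shows "exp z \<le> 1 + z + z\<^sup>2"
proof (cases "z \<ge> 0")
  case True
  then show ?thesis using exp_bound[of z] assms by simp
next
  case False
  then have "0 < 1 - z" by simp
  have "exp z \<le> inverse (1 - z)"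
    using exp_ge_add_one_self[of "- z"] \<open>0 < 1 - z\<close> by (simp add: exp_minus inverse_le_iff field_simps)
  also have "\<dots> \<le> 1 + z + z\<^sup>2"
  proof -
    have "z ^ 3 \<le> 0" using False by (simp add: power_le_zero_eq)
    then have "1 \<le> (1 + z + z\<^sup>2) * (1 - z)" by (simp add: algebra_simps power2_eq_square power3_eq_cube)
    then show ?thesis using \<open>0 < 1 - z\<close> by (simp add: field_simps)
  qed
  finally show ?thesis .
qed

lemma integral_gaussian_euclidean:
  fixes c :: real
  assumes "c > 0"
  shows "integrable lborel (\<lambda>x::'a::euclidean_space. exp (- c * (norm x)\<^sup>2))"
    and "(\<integral>(x::'a). exp (- c * (norm x)\<^sup>2) \<partial>lborel) = (pi / c) powr (DIM('a) / 2)"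
proof -
  define \<sigma> where "\<sigma> = sqrt (1 / (2 * c))"
  have \<sigma>: "\<sigma> > 0" "\<sigma>\<^sup>2 = 1 / (2 * c)" using assms by (auto simp: \<sigma>_def)
  have eq: "exp (- c * x\<^sup>2) = sqrt (pi / c) * normal_density 0 \<sigma> x" for x
    using assms \<sigma>(1) by (simp add: normal_density_def \<sigma>(2) real_sqrt_divide)
  have one: "(\<integral>\<^sup>+x. ennreal (exp (- c * x\<^sup>2)) \<partial>lborel) = ennreal (sqrt (pi / c))"
    unfolding eq using assms \<sigma>
    by (subst nn_integral_eq_integral) (auto intro!: integrable_mult_right)
  have "(\<integral>\<^sup>+(x::'a). ennreal (exp (- c * (norm x)\<^sup>2)) \<partial>lborel)
      = (\<integral>\<^sup>+(x::'a). (\<Prod>b\<in>Basis. ennreal (exp (- c * (x \<bullet> b)\<^sup>2))) \<partial>lborel)"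
    by (intro nn_integral_cong)
       (simp add: prod_ennreal exp_sum[symmetric] norm_eq_sqrt_inner euclidean_inner[of x x for x]
          sum_distrib_left power2_eq_square sum_nonneg sum_negf)
  also have "\<dots> = (\<Prod>b\<in>(Basis::'a set). (\<integral>\<^sup>+x. ennreal (exp (- c * x\<^sup>2)) \<partial>lborel))"
    by (rule nn_integral_lborel_prod) auto
  also have "\<dots> = ennreal ((pi / c) powr (DIM('a) / 2))"
  proof -
    have "sqrt (pi / c) ^ DIM('a) = ((pi / c) powr (1 / 2)) powr real DIM('a)"
      using assms by (simp only: powr_half_sqrt powr_realpow real_sqrt_gt_0_iff divide_pos_pos pi_gt_zero less_imp_le)
    also have "\<dots> = (pi / c) powr (DIM('a) / 2)" by (simp add: powr_powr)
    finally show ?thesis unfolding one using assms by (simp add: ennreal_power)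
  qed
  finally have nn: "(\<integral>\<^sup>+(x::'a). ennreal (exp (- c * (norm x)\<^sup>2)) \<partial>lborel) = ennreal ((pi / c) powr (DIM('a) / 2))" .
  show int: "integrable lborel (\<lambda>x::'a. exp (- c * (norm x)\<^sup>2))"
    by (rule integrableI_nonneg) (auto simp: nn[simplified])
  show "(\<integral>(x::'a). exp (- c * (norm x)\<^sup>2) \<partial>lborel) = (pi / c) powr (DIM('a) / 2)"
    using nn by (subst integral_eq_nn_integral) auto
qed

lemma integrable_powr_mult_exp:
  fixes \<phi> :: "'a::euclidean_space \<Rightarrow> real"
  assumes [measurable]: "\<phi> \<in> borel_measurable borel"
    and growth: "\<And>x. c0 + c1 * (norm x)\<^sup>2 \<le> \<phi> x" "c1 > 0" and "k \<ge> 0"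
  shows "integrable lborel (\<lambda>x. norm x powr k * exp (- \<phi> x))"
proof (rule Bochner_Integration.integrable_bound)
  show "integrable lborel (\<lambda>x::'a. exp (k\<^sup>2 / (2 * c1) - c0) * exp (- (c1 / 2) * (norm x)\<^sup>2))"
    using growth(2) by (intro integrable_mult_right integral_gaussian_euclidean) auto
  show "AE x in lborel. norm (norm x powr k * exp (- \<phi> x)) \<le>
      norm (exp (k\<^sup>2 / (2 * c1) - c0) * exp (- (c1 / 2) * (norm x)\<^sup>2))"
  proof (rule AE_I2)
    fix x :: 'a
    \<comment> \<open>As ln t is at most t, the power is traded for an exponential of the norm; half
      of the quadratic exponent then absorbs this linear one.\<close>
    have "norm x powr k \<le> exp (k * norm x)"
      using \<open>k \<ge> 0\<close> ln_bound[of "norm x"] by (auto simp: powr_def mult_left_mono)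
    moreover have "exp (- \<phi> x) \<le> exp (- (c0 + c1 * (norm x)\<^sup>2))" using growth(1)[of x] by simp
    ultimately have "norm x powr k * exp (- \<phi> x) \<le> exp (k * norm x) * exp (- (c0 + c1 * (norm x)\<^sup>2))"
      by (intro mult_mono) auto
    also have "\<dots> \<le> exp (k\<^sup>2 / (2 * c1) - c0) * exp (- (c1 / 2) * (norm x)\<^sup>2)"
    proof -
      have "0 \<le> (k - c1 * norm x)\<^sup>2 / (2 * c1)" using growth(2) by simp
      also have "\<dots> = k\<^sup>2 / (2 * c1) - k * norm x + c1 / 2 * (norm x)\<^sup>2"
        using growth(2) by (simp add: power2_eq_square field_simps)
      finally show ?thesis by (simp flip: exp_add)
    qed
    finally show "norm (norm x powr k * exp (- \<phi> x)) \<le>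
      norm (exp (k\<^sup>2 / (2 * c1) - c0) * exp (- (c1 / 2) * (norm x)\<^sup>2))" by simp
  qed
qed measurable

lemma integral_lborel_scaleR:
  fixes f :: "'a::euclidean_space \<Rightarrow> real"
  assumes [measurable]: "f \<in> borel_measurable borel" and "c > 0"
  shows "(\<integral>x. f x \<partial>lborel) = (\<integral>x. c ^ DIM('a) * f (t + c *\<^sub>R x) \<partial>lborel)"
proof -
  have "(\<integral>x. f x \<partial>lborel) = (\<integral>x. f x \<partial>density (distr lborel borel (\<lambda>x. t + c *\<^sub>R x)) (\<lambda>_. ennreal (c ^ DIM('a))))"
    using lborel_affine[of c t] \<open>c > 0\<close> by simp
  also have "\<dots> = (\<integral>x. c ^ DIM('a) * f (t + c *\<^sub>R x) \<partial>lborel)"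
    using \<open>c > 0\<close> by (subst integral_density) (auto simp: integral_distr)
  finally show ?thesis .
qed

lemma integrable_lborel_scaleR:
  fixes f :: "'a::euclidean_space \<Rightarrow> real"
  assumes [measurable]: "f \<in> borel_measurable borel" and "c > 0" and int: "integrable lborel f"
  shows "integrable lborel (\<lambda>x. f (t + c *\<^sub>R x))"
proof -
  have "density (distr lborel borel (\<lambda>x. t + c *\<^sub>R x)) (\<lambda>_. ennreal (c ^ DIM('a))) = lborel"
    using lborel_affine[of c t] \<open>c > 0\<close> by simp
  with int have "integrable (density (distr lborel borel (\<lambda>x. t + c *\<^sub>R x)) (\<lambda>_. ennreal (c ^ DIM('a)))) f"
    by simp
  then have "integrable lborel (\<lambda>x. c ^ DIM('a) * f (t + c *\<^sub>R x))"
    using \<open>c > 0\<close> by (simp add: integrable_density integrable_distr_eq)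
  then show ?thesis using \<open>c > 0\<close> by simp
qed

text \<open>A substitute for integrating \<open>div (x |x|\<^sup>r e\<^sup>-\<^sup>\<phi>)\<close> by parts that needs no differentiability:
  rescaling \<open>x\<close> to \<open>(1 + \<epsilon>) x\<close> leaves the integral of \<open>|x|\<^sup>r e\<^sup>-\<^sup>\<phi>\<close> unchanged up to the Jacobian, the subgradient
  inequality controls the new exponent, and the first order term in \<open>\<epsilon>\<close> gives the claim.\<close>

lemma gibbs_weighted_moment_step:
  fixes \<phi> :: "'a::euclidean_space \<Rightarrow> real"
  assumes [measurable]: "\<phi> \<in> borel_measurable borel"
    and growth: "\<And>x. c0 + c1 * (norm x)\<^sup>2 \<le> \<phi> x" "c1 > 0"
    and sel: "is_selection L \<phi> g" "L \<ge> 0"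
    and diss: "\<And>x. \<alpha> * (norm x)\<^sup>2 - b \<le> g x \<bullet> x" "\<alpha> > 0"
    and "r \<ge> 0"
  shows "\<alpha> * (\<integral>x. norm x powr (r + 2) * exp (- \<phi> x) \<partial>lborel)
    \<le> (b + DIM('a) + r) * (\<integral>x. norm x powr r * exp (- \<phi> x) \<partial>lborel)"
proof -
  define w where "w x = norm x powr r * exp (- \<phi> x)" for x
  \<comment> \<open>\<open>N\<close> is the joint homogeneity of Jacobian and weight.
    \<open>I\<close> is the coefficient of \<epsilon> in the expansion and \<open>B\<close>
    dominates that of its square; the claim is that \<open>I\<close> is nonnegative.\<close>
  define N where "N = DIM('a) + r"
  define I where "I = (\<integral>x. w x * (N + b - \<alpha> * (norm x)\<^sup>2) \<partial>lborel)"
  define B where "B = (\<integral>x. w x * (L / 2 * (norm x)\<^sup>2 + (N + b + \<alpha> * (norm x)\<^sup>2)\<^sup>2) \<partial>lborel)"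
  have [measurable]: "w \<in> borel_measurable borel" unfolding w_def by measurable
  have "b \<ge> 0" using diss(1)[of 0] by simp
  have "N \<ge> 0" using \<open>r \<ge> 0\<close> by (simp add: N_def)
  have w_nonneg: "w x \<ge> 0" for x by (simp add: w_def)
  have pow: "norm x powr r * (norm x) ^ k = norm x powr (r + real k)" if "k > 0" for x :: 'a and k
    using that by (cases "x = 0") (auto simp: powr_add powr_realpow)
  have pow': "w x * norm x ^ k = norm x powr (r + real k) * exp (- \<phi> x)" if "k > 0" for x and k
    using pow[OF that, of x] by (simp add: w_def mult_ac)
  have int: "integrable lborel (\<lambda>x. w x * norm x ^ k)" for k
  proof (cases "k = 0")
    case True
    then show ?thesis using \<open>r \<ge> 0\<close> integrable_powr_mult_exp[OF assms(1) growth, of r] by (simp add: w_def)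
  next
    case False
    then show ?thesis using \<open>r \<ge> 0\<close> integrable_powr_mult_exp[OF assms(1) growth, of "r + real k"] by (simp add: pow')
  qed
  have int0: "integrable lborel w" using int[of 0] by simp
  have int_I: "integrable lborel (\<lambda>x. w x * (N + b - \<alpha> * (norm x)\<^sup>2))"
  proof -
    have "integrable lborel (\<lambda>x. (N + b) * (w x * norm x ^ 0) - \<alpha> * (w x * norm x ^ 2))"
      by (intro Bochner_Integration.integrable_diff integrable_mult_right int)
    then show ?thesis by (simp add: algebra_simps)
  qed
  have int_B: "integrable lborel (\<lambda>x. w x * (L / 2 * (norm x)\<^sup>2 + (N + b + \<alpha> * (norm x)\<^sup>2)\<^sup>2))"
  proof -
    have "integrable lborel (\<lambda>x. (N + b)\<^sup>2 * (w x * norm x ^ 0)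
        + (L / 2 + 2 * (N + b) * \<alpha>) * (w x * norm x ^ 2) + \<alpha>\<^sup>2 * (w x * norm x ^ 4))"
      by (intro Bochner_Integration.integrable_add integrable_mult_right int)
    also have "(\<lambda>x. (N + b)\<^sup>2 * (w x * norm x ^ 0)
        + (L / 2 + 2 * (N + b) * \<alpha>) * (w x * norm x ^ 2) + \<alpha>\<^sup>2 * (w x * norm x ^ 4))
       = (\<lambda>x. w x * (L / 2 * (norm x)\<^sup>2 + (N + b + \<alpha> * (norm x)\<^sup>2)\<^sup>2))"
      by (rule ext) (simp add: algebra_simps power2_eq_square power4_eq_xxxx)
    finally show ?thesis .
  qed
  \<comment> \<open>The condition on \<open>\<epsilon> * L\<close> lets dissipation dominate the
    semi-convexity error, so that \<open>y\<close> below is at most \<open>N + b\<close>. The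
    condition on \<open>\<epsilon> * (N + b)\<close> then makes \<open>\<epsilon> * y\<close> at
    most 1, as \<open>exp_le_quadratic\<close> requires.\<close>
  have key: "0 \<le> I + \<epsilon> * B"
    if \<epsilon>: "0 < \<epsilon>" "\<epsilon> * L \<le> 2 * \<alpha>" "\<epsilon> * (N + b) \<le> 1" for \<epsilon>
  proof -
    have "(\<integral>x. w x \<partial>lborel) = (\<integral>x. (1 + \<epsilon>) ^ DIM('a) * w (0 + (1 + \<epsilon>) *\<^sub>R x) \<partial>lborel)"
      using \<epsilon> by (intro integral_lborel_scaleR) auto
    also have "\<dots> \<le> (\<integral>x. w x + (\<epsilon> * (w x * (N + b - \<alpha> * (norm x)\<^sup>2))
         + \<epsilon>\<^sup>2 * (w x * (L / 2 * (norm x)\<^sup>2 + (N + b + \<alpha> * (norm x)\<^sup>2)\<^sup>2))) \<partial>lborel)"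
    proof (rule integral_mono')
      show "integrable lborel (\<lambda>x. w x + (\<epsilon> * (w x * (N + b - \<alpha> * (norm x)\<^sup>2))
         + \<epsilon>\<^sup>2 * (w x * (L / 2 * (norm x)\<^sup>2 + (N + b + \<alpha> * (norm x)\<^sup>2)\<^sup>2))))"
        by (intro Bochner_Integration.integrable_add integrable_mult_right int0 int_I int_B)
    next
      fix x :: 'a
      define s where "s = (norm x)\<^sup>2"
      \<comment> \<open>\<open>\<epsilon> * y\<close> bounds the exponent of the ratio of rescaled
        to original weight: \<open>N\<close> from the scaling, \<open>b - \<alpha> * s\<close> from
        dissipativity, the rest from semi-convexity.\<close>
      define y where "y = N + b - \<alpha> * s + \<epsilon> * L / 2 * s"
      have "s \<ge> 0" by (simp add: s_def)
      have "\<epsilon> * L / 2 * s \<le> \<alpha> * s" using \<epsilon> \<open>s \<ge> 0\<close> by (intro mult_right_mono) auto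
      moreover have "0 \<le> \<epsilon> * L / 2 * s" "0 \<le> \<alpha> * s" using \<epsilon> sel(2) diss(2) \<open>s \<ge> 0\<close> by auto
      ultimately have y: "y \<le> N + b" "\<bar>y\<bar> \<le> N + b + \<alpha> * s"
        using \<open>N \<ge> 0\<close> \<open>b \<ge> 0\<close> by (auto simp: y_def abs_le_iff)
      have "\<epsilon> * y \<le> \<epsilon> * (N + b)" using y(1) \<epsilon> by (intro mult_left_mono) auto
      then have "\<epsilon> * y \<le> 1" using \<epsilon> by linarith
      have "y\<^sup>2 \<le> (N + b + \<alpha> * s)\<^sup>2" using power_mono[OF y(2), of 2] by simp
      have "(1 + \<epsilon>) ^ DIM('a) * (1 + \<epsilon>) powr r = (1 + \<epsilon>) powr N"
        using \<epsilon> by (simp add: N_def powr_add powr_realpow)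
      also have "\<dots> = exp (N * ln (1 + \<epsilon>))" using \<epsilon> by (simp add: powr_def)
      also have "\<dots> \<le> exp (N * \<epsilon>)"
        using \<epsilon> \<open>N \<ge> 0\<close> ln_add_one_self_le_self[of \<epsilon>] by (simp add: mult_left_mono)
      finally have 1: "(1 + \<epsilon>) ^ DIM('a) * (1 + \<epsilon>) powr r \<le> exp (N * \<epsilon>)" .
      have "\<phi> x + g x \<bullet> (\<epsilon> *\<^sub>R x) - L / 2 * (norm (\<epsilon> *\<^sub>R x))\<^sup>2 \<le> \<phi> ((1 + \<epsilon>) *\<^sub>R x)"
        using is_selectionD[OF sel(1), of x "(1 + \<epsilon>) *\<^sub>R x"] by (simp add: algebra_simps)
      moreover have "\<epsilon> * (\<alpha> * s - b) \<le> g x \<bullet> (\<epsilon> *\<^sub>R x)"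
        using diss(1)[of x] \<epsilon> by (simp add: s_def)
      moreover have "(norm (\<epsilon> *\<^sub>R x))\<^sup>2 = \<epsilon>\<^sup>2 * s" by (simp add: s_def power_mult_distrib)
      ultimately have "- \<phi> ((1 + \<epsilon>) *\<^sub>R x) \<le> - \<phi> x - \<epsilon> * (\<alpha> * s - b) + L / 2 * (\<epsilon>\<^sup>2 * s)"
        by simp
      also have "\<dots> = - \<phi> x + (\<epsilon> * y - N * \<epsilon>)"
        by (simp add: y_def algebra_simps power2_eq_square)
      finally have 2: "exp (- \<phi> ((1 + \<epsilon>) *\<^sub>R x)) \<le> exp (- \<phi> x) * exp (\<epsilon> * y - N * \<epsilon>)"
        by (simp flip: exp_add)
      have "(1 + \<epsilon>) ^ DIM('a) * w (0 + (1 + \<epsilon>) *\<^sub>R x) =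
          ((1 + \<epsilon>) ^ DIM('a) * (1 + \<epsilon>) powr r) * norm x powr r * exp (- \<phi> ((1 + \<epsilon>) *\<^sub>R x))"
        using \<epsilon> by (simp add: w_def powr_mult)
      also have "\<dots> \<le> exp (N * \<epsilon>) * norm x powr r * (exp (- \<phi> x) * exp (\<epsilon> * y - N * \<epsilon>))"
        using 1 2 by (intro mult_mono) auto
      also have "\<dots> = w x * exp (\<epsilon> * y)"
        by (simp add: w_def exp_diff)
      also have "\<dots> \<le> w x * (1 + \<epsilon> * y + (\<epsilon> * y)\<^sup>2)"
        using \<open>\<epsilon> * y \<le> 1\<close> w_nonneg by (intro mult_left_mono exp_le_quadratic) auto
      also have "\<dots> \<le> w x * (1 + \<epsilon> * y + \<epsilon>\<^sup>2 * (N + b + \<alpha> * s)\<^sup>2)"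
        using \<open>y\<^sup>2 \<le> _\<close> w_nonneg by (intro mult_left_mono add_left_mono) (auto simp: power_mult_distrib mult_left_mono)
      also have "\<dots> = w x + (\<epsilon> * (w x * (N + b - \<alpha> * s)) + \<epsilon>\<^sup>2 * (w x * (L / 2 * s + (N + b + \<alpha> * s)\<^sup>2)))"
        by (simp add: y_def algebra_simps power2_eq_square)
      finally show "(1 + \<epsilon>) ^ DIM('a) * w (0 + (1 + \<epsilon>) *\<^sub>R x) \<le> w x + (\<epsilon> * (w x * (N + b - \<alpha> * (norm x)\<^sup>2))
         + \<epsilon>\<^sup>2 * (w x * (L / 2 * (norm x)\<^sup>2 + (N + b + \<alpha> * (norm x)\<^sup>2)\<^sup>2)))"
        by (simp add: s_def)
      have "0 \<le> (1 + \<epsilon>) ^ DIM('a) * w (0 + (1 + \<epsilon>) *\<^sub>R x)" using \<epsilon> w_nonneg by simp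
      then show "0 \<le> w x + (\<epsilon> * (w x * (N + b - \<alpha> * (norm x)\<^sup>2))
         + \<epsilon>\<^sup>2 * (w x * (L / 2 * (norm x)\<^sup>2 + (N + b + \<alpha> * (norm x)\<^sup>2)\<^sup>2)))"
        using \<open>(1 + \<epsilon>) ^ DIM('a) * w (0 + (1 + \<epsilon>) *\<^sub>R x) \<le> _\<close> by linarith
    qed
    also have "\<dots> = (\<integral>x. w x \<partial>lborel) + (\<epsilon> * I + \<epsilon>\<^sup>2 * B)"
      unfolding I_def B_def
      by (subst Bochner_Integration.integral_add Bochner_Integration.integral_mult_right_zero;
          (intro Bochner_Integration.integrable_add integrable_mult_right int0 int_I int_B)?)+ simp
    finally have "0 \<le> \<epsilon> * (I + \<epsilon> * B)" by (simp add: algebra_simps power2_eq_square)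
    then show ?thesis using \<epsilon> by (simp add: zero_le_mult_iff)
  qed
  have "0 \<le> I"
  proof (rule tendsto_lowerbound)
    show "((\<lambda>\<epsilon>. I + \<epsilon> * B) \<longlongrightarrow> I) (at_right 0)"
      by (auto intro!: tendsto_eq_intros)
    have "((\<lambda>\<epsilon>. \<epsilon> * L) \<longlongrightarrow> 0) (at_right 0)" "((\<lambda>\<epsilon>. \<epsilon> * (N + b)) \<longlongrightarrow> 0) (at_right 0)"
      by (auto intro!: tendsto_eq_intros)
    then have "\<forall>\<^sub>F \<epsilon> in at_right 0. \<epsilon> * L < 2 * \<alpha>" "\<forall>\<^sub>F \<epsilon> in at_right 0. \<epsilon> * (N + b) < 1"
      using diss(2) by (auto intro: order_tendstoD(2))
    then show "\<forall>\<^sub>F \<epsilon> in at_right 0. 0 \<le> I + \<epsilon> * B"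
      using eventually_at_right_less[of "0::real"] by eventually_elim (use key in auto)
  qed simp
  also have "I = (\<integral>x. (N + b) * w x - \<alpha> * (w x * norm x ^ 2) \<partial>lborel)"
    unfolding I_def by (intro Bochner_Integration.integral_cong) (auto simp: algebra_simps)
  also have "\<dots> = (N + b) * (\<integral>x. w x \<partial>lborel) - \<alpha> * (\<integral>x. w x * norm x ^ 2 \<partial>lborel)"
    using int0 int[of 2] by (simp add: Bochner_Integration.integral_diff)
  also have "(\<lambda>x. w x * norm x ^ 2) = (\<lambda>x. norm x powr (r + 2) * exp (- \<phi> x))"
    using pow'[of 2] by auto
  finally show ?thesis by (simp add: w_def N_def add_ac)
qed

text \<open>Young's inequality with weights 2 / q and 1 - 2 / q, used to trade a moment of order q -
  2 for a share less than 1 of the moment of order q. At \<open>t = 0\<close> the left side is 0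
  even for \<open>q = 2\<close>, since 0 powr 0 = 0, so no null set has to be excluded.\<close>

lemma weighted_young:
  fixes c t q :: real
  assumes "c \<ge> 0" "t \<ge> 0" "q \<ge> 2"
  shows "c * t powr (q - 2) \<le> 2 / q * c powr (q / 2) + (1 - 2 / q) * t powr q"
proof (cases "c = 0 \<or> t = 0")
  case True
  then show ?thesis using assms by auto
next
  case False
  then have "(c powr (q / 2)) powr (2 / q) * (t powr q) powr (1 - 2 / q)
      \<le> 2 / q * c powr (q / 2) + (1 - 2 / q) * t powr q"
    using assms by (intro Youngs_inequality_0) auto
  moreover have "q * (1 - 2 / q) = q - 2" using assms by (simp add: field_simps)
  ultimately show ?thesis using False assms by (simp add: powr_powr)
qed

text \<open>The step lemma with weight exponent \<open>q - 2\<close> bounds the moment by one of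
  lower order. Young's inequality returns the share 1 - 2 / q of the original moment, which is
  finite and can be absorbed; dividing by the remaining 2 / q gives the constant.\<close>

lemma gibbs_weighted_moment_bound:
  fixes \<phi> :: "'a::euclidean_space \<Rightarrow> real"
  assumes [measurable]: "\<phi> \<in> borel_measurable borel"
    and growth: "\<And>x. c0 + c1 * (norm x)\<^sup>2 \<le> \<phi> x" "c1 > 0"
    and sel: "is_selection L \<phi> g" "L \<ge> 0"
    and diss: "\<And>x. \<alpha> * (norm x)\<^sup>2 - b \<le> g x \<bullet> x" "\<alpha> > 0"
    and "q \<ge> 2"
  shows "(\<integral>x. norm x powr q * exp (- \<phi> x) \<partial>lborel)
    \<le> ((b + DIM('a) + q - 2) / \<alpha>) powr (q / 2) * (\<integral>x. exp (- \<phi> x) \<partial>lborel)"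
proof -
  define c where "c = (b + DIM('a) + q - 2) / \<alpha>"
  note integrable = integrable_powr_mult_exp[OF assms(1) growth]
  have "b \<ge> 0" using diss(1)[of 0] by simp
  then have "c \<ge> 0" using \<open>q \<ge> 2\<close> diss(2) by (simp add: c_def)
  have int0: "integrable lborel (\<lambda>x. exp (- \<phi> x))"
    by (rule Bochner_Integration.integrable_bound[OF integrable_mult_right[OF integral_gaussian_euclidean(1)[OF growth(2)], of "exp (- c0)"]])
       (use growth(1) in \<open>auto simp: algebra_simps simp flip: exp_add\<close>)
  define X where "X = (\<integral>x. norm x powr q * exp (- \<phi> x) \<partial>lborel)"
  have "\<alpha> * X \<le> (b + DIM('a) + (q - 2)) * (\<integral>x. norm x powr (q - 2) * exp (- \<phi> x) \<partial>lborel)"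
    using gibbs_weighted_moment_step[OF assms(1) growth sel diss, of "q - 2"] \<open>q \<ge> 2\<close> by (simp add: X_def)
  then have "X \<le> c * (\<integral>x. norm x powr (q - 2) * exp (- \<phi> x) \<partial>lborel)"
    using diss(2) by (simp add: c_def field_simps)
  also have "\<dots> = (\<integral>x. c * (norm x powr (q - 2) * exp (- \<phi> x)) \<partial>lborel)" by simp
  also have "\<dots> \<le> (\<integral>x. 2 / q * c powr (q / 2) * exp (- \<phi> x) + (1 - 2 / q) * (norm x powr q * exp (- \<phi> x)) \<partial>lborel)"
  proof (rule integral_mono)
    fix x :: 'a
    have "c * norm x powr (q - 2) * exp (- \<phi> x)
        \<le> (2 / q * c powr (q / 2) + (1 - 2 / q) * norm x powr q) * exp (- \<phi> x)"
      using \<open>c \<ge> 0\<close> \<open>q \<ge> 2\<close> by (intro mult_right_mono weighted_young) auto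
    then show "c * (norm x powr (q - 2) * exp (- \<phi> x))
        \<le> 2 / q * c powr (q / 2) * exp (- \<phi> x) + (1 - 2 / q) * (norm x powr q * exp (- \<phi> x))"
      by (simp add: algebra_simps)
  qed (use \<open>q \<ge> 2\<close> in \<open>intro Bochner_Integration.integrable_add integrable_mult_right int0 integrable; simp\<close>)+
  also have "\<dots> = 2 / q * c powr (q / 2) * (\<integral>x. exp (- \<phi> x) \<partial>lborel) + (1 - 2 / q) * X"
    using int0 integrable[of q] \<open>q \<ge> 2\<close> unfolding X_def
    by (subst Bochner_Integration.integral_add) (auto intro: integrable_mult_right)
  finally have "2 / q * X \<le> 2 / q * (c powr (q / 2) * (\<integral>x. exp (- \<phi> x) \<partial>lborel))"
    by (simp add: algebra_simps)
  then show ?thesis using \<open>q \<ge> 2\<close> by (simp add: X_def c_def divide_le_cancel)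
qed

section \<open>Dissipativity and the tamed step\<close>

text \<open>The two entries of the maximum belong to two cases. Far out, monotonicity against 0
  gives \<mu> |x|^2, half of which pays for m |x|. Inside radius \<open>R\<close>, adding the
  subgradient inequalities at x and at 0 gives monotonicity up to - L |x|^2, and what remains is
  largest at \<open>R\<close>.\<close>

lemma dissipative_of_strongly_monotone_at_infinity:
  fixes u :: "'a::real_inner \<Rightarrow> real"
  assumes sel: "is_selection L u h" and "L \<ge> 0" "\<mu> > 0" "R \<ge> 0"
    and mono: "\<And>x. norm x \<ge> R \<Longrightarrow> (h x - h 0) \<bullet> x \<ge> \<mu> * (norm x)\<^sup>2"
    and h0: "norm (h 0) \<le> m"
  shows "\<mu> / 2 * (norm x)\<^sup>2 - max (m\<^sup>2 / (2 * \<mu>)) (m * R + (L + \<mu> / 2) * R\<^sup>2) \<le> h x \<bullet> x"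
proof -
  have "- (h 0 \<bullet> x) \<le> norm (h 0) * norm x" using Cauchy_Schwarz_ineq2[of "h 0" x] by simp
  also have "\<dots> \<le> m * norm x" using h0 by (rule mult_right_mono) simp
  finally have h0x: "- (m * norm x) \<le> h 0 \<bullet> x" by simp
  have "m \<ge> 0" using h0 norm_ge_zero order_trans by blast
  show ?thesis
  proof (cases "norm x \<ge> R")
    case True
    have "0 \<le> (\<mu> * norm x - m)\<^sup>2 / (2 * \<mu>)" using \<open>\<mu> > 0\<close> by simp
    also have "\<dots> = \<mu> / 2 * (norm x)\<^sup>2 - m * norm x + m\<^sup>2 / (2 * \<mu>)"
      using \<open>\<mu> > 0\<close> by (simp add: power2_eq_square field_simps)
    finally have "\<mu> / 2 * (norm x)\<^sup>2 - m\<^sup>2 / (2 * \<mu>) \<le> \<mu> * (norm x)\<^sup>2 - m * norm x"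
      by (simp add: algebra_simps)
    also have "\<dots> \<le> h x \<bullet> x" using mono[OF True] h0x by (simp add: inner_diff_left)
    finally show ?thesis by linarith
  next
    case False
    have "h x \<bullet> x \<ge> h 0 \<bullet> x - L * (norm x)\<^sup>2"
      using is_selectionD[OF sel, of x 0] is_selectionD[OF sel, of 0 x] by simp
    then have "h x \<bullet> x \<ge> \<mu> / 2 * (norm x)\<^sup>2 - (m * norm x + (L + \<mu> / 2) * (norm x)\<^sup>2)"
      using h0x by (simp add: algebra_simps)
    moreover have "m * norm x + (L + \<mu> / 2) * (norm x)\<^sup>2 \<le> m * R + (L + \<mu> / 2) * R\<^sup>2"
      using False assms \<open>m \<ge> 0\<close> by (intro add_mono mult_left_mono power_mono) auto
    ultimately show ?thesis by linarith
  qed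
qed

text \<open>Once the squared radius exceeds 4 b / \<mu>, the radial slope is at least \<mu> / 4
  times the radius, which integrates to the coefficient \<mu> / 8. Inside that ball the lower bound
  \<open>u0\<close> suffices.\<close>

lemma quadratic_growth_of_dissipative:
  fixes u :: "'a::real_inner \<Rightarrow> real"
  assumes sel: "is_selection L u h" and "\<mu> > 0" "b \<ge> 0"
    and diss: "\<And>x. \<mu> / 2 * (norm x)\<^sup>2 - b \<le> h x \<bullet> x"
    and lower: "\<And>x. u0 \<le> u x"
  shows "u0 - \<mu> / 8 * (sqrt (4 * b / \<mu>) + 1)\<^sup>2 + \<mu> / 8 * (norm x)\<^sup>2 \<le> u x"
proof -
  \<comment> \<open>The summand 1 keeps \<open>T\<close> positive when \<open>b = 0\<close>, so that
    the direction \<open>v\<close> and division by the radius make sense.\<close>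
  define T where "T = sqrt (4 * b / \<mu>) + 1"
  have T: "T \<ge> 1" using assms by (simp add: T_def)
  show ?thesis
  proof (cases "norm x \<le> T")
    case True
    then have "\<mu> / 8 * (norm x)\<^sup>2 \<le> \<mu> / 8 * T\<^sup>2"
      using \<open>\<mu> > 0\<close> by (intro mult_left_mono power_mono) auto
    then show ?thesis using lower[of x] unfolding T_def by linarith
  next
    case False
    define v where "v = x /\<^sub>R norm x"
    have "norm x \<noteq> 0" using False T by linarith
    then have v: "norm v = 1" "norm x *\<^sub>R v = x" using False T norm_ge_zero[of x] by (auto simp: v_def)
    have "u (T *\<^sub>R v) - \<mu> / 8 * T\<^sup>2 \<le> u (norm x *\<^sub>R v) - \<mu> / 8 * (norm x)\<^sup>2"
    proof (rule le_of_quadratic_defect[where f = "\<lambda>t. u (t *\<^sub>R v) - \<mu> / 8 * t\<^sup>2" and C = "L / 2 + \<mu> / 8"])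
      fix s t assume st: "T \<le> s" "s \<le> t" "t \<le> norm x"
      then have "s > 0" using T by linarith
      have "4 * b / \<mu> = (sqrt (4 * b / \<mu>))\<^sup>2" using assms by simp
      also have "\<dots> \<le> s\<^sup>2" using st assms by (intro power_mono) (auto simp: T_def)
      finally have "b \<le> \<mu> / 4 * s\<^sup>2" using \<open>\<mu> > 0\<close> by (simp add: field_simps)
      moreover have "\<mu> / 2 * s\<^sup>2 - b \<le> s * (h (s *\<^sub>R v) \<bullet> v)"
        using diss[of "s *\<^sub>R v"] v \<open>s > 0\<close> by (simp add: power_mult_distrib)
      ultimately have "s * (\<mu> / 4 * s) \<le> s * (h (s *\<^sub>R v) \<bullet> v)"
        by (simp add: power2_eq_square algebra_simps)
      then have hv: "\<mu> / 4 * s \<le> h (s *\<^sub>R v) \<bullet> v" using \<open>s > 0\<close> by simp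
      have "u (s *\<^sub>R v) + (t - s) * (h (s *\<^sub>R v) \<bullet> v) - L / 2 * (t - s)\<^sup>2 \<le> u (t *\<^sub>R v)"
        using is_selectionD[OF sel, of "s *\<^sub>R v" "t *\<^sub>R v"] v
        by (simp add: algebra_simps flip: scaleR_diff_left)
      moreover have "(t - s) * (\<mu> / 4 * s) \<le> (t - s) * (h (s *\<^sub>R v) \<bullet> v)"
        using st hv by (intro mult_left_mono) auto
      \<comment> \<open>The slope at the earlier point underestimates the increment of \<mu> / 8 t^2
        by a quadratic term, which is why \<mu> / 8 enters \<open>C\<close>.\<close>
      moreover have "(t - s) * (\<mu> / 4 * s) = \<mu> / 8 * t\<^sup>2 - \<mu> / 8 * s\<^sup>2 - \<mu> / 8 * (t - s)\<^sup>2"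
        by (simp add: power2_eq_square field_simps)
      moreover have "- (L / 2 + \<mu> / 8) * (t - s)\<^sup>2 = - (L / 2 * (t - s)\<^sup>2) - \<mu> / 8 * (t - s)\<^sup>2"
        by (simp add: algebra_simps)
      ultimately show "- (L / 2 + \<mu> / 8) * (t - s)\<^sup>2
          \<le> u (t *\<^sub>R v) - \<mu> / 8 * t\<^sup>2 - (u (s *\<^sub>R v) - \<mu> / 8 * s\<^sup>2)"
        by linarith
    qed (use False in auto)
    then show ?thesis using lower[of "T *\<^sub>R v"] v unfolding T_def by simp
  qed
qed

lemma norm_minimiser_bound:
  fixes u :: "'a::real_inner \<Rightarrow> real"
  assumes "\<mu> > 0" "g \<bullet> x = 0" "\<mu> / 2 * (norm x)\<^sup>2 - b \<le> g \<bullet> x"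
  shows "(norm x)\<^sup>2 \<le> 2 * b / \<mu>"
  using assms by (simp add: field_simps)

section \<open>Gaussian noise and the tamed drift\<close>

lemma std_gaussian_density_eq:
  "std_gaussian_density (x :: real ^ 'd) = (2 * pi) powr (- (CARD('d) / 2)) * exp (- (1 / 2) * (norm x)\<^sup>2)"
proof -
  have "(norm x)\<^sup>2 = (\<Sum>i\<in>UNIV. (x $ i)\<^sup>2)"
    by (simp add: norm_vec_def L2_set_def sum_nonneg)
  then have "exp (- (1 / 2) * (norm x)\<^sup>2) = (\<Prod>i\<in>UNIV. exp (- (x $ i)\<^sup>2 / 2))"
    by (simp add: exp_sum[symmetric] sum_divide_distrib sum_negf)
  moreover have "(1 / sqrt (2 * pi)) ^ CARD('d) = (2 * pi) powr (- (CARD('d) / 2))"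
  proof -
    have "1 / sqrt (2 * pi) = (2 * pi) powr (- (1 / 2))"
      by (simp add: powr_minus powr_half_sqrt inverse_eq_divide)
    then show ?thesis
      by (simp only: powr_realpow[symmetric] powr_gt_zero pi_neq_zero) (simp add: powr_powr powr_realpow[symmetric])
  qed
  ultimately show ?thesis
    by (simp only: std_gaussian_density_def std_normal_density_def prod.distrib prod_constant)
qed

text \<open>The law of \<open>\<Delta> + \<sigma> \<xi>\<close> is the Gibbs measure of the dissipative potential \<open>|y - \<Delta>|\<^sup>2 / (2 \<sigma>\<^sup>2)\<close>, so the moment
  bound for Gibbs measures applies to it. The leading coefficient 1 of \<open>|\<Delta>|\<^sup>2\<close> is what lets the bound
  be iterated along the chain.\<close>

lemma gaussian_shift_moment_bound:
  fixes \<Delta> :: "real ^ 'd" and \<sigma> q :: real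
  assumes "\<sigma> > 0" "q \<ge> 2"
  shows "(\<integral>\<^sup>+x. ennreal (norm (\<Delta> + \<sigma> *\<^sub>R x) powr q) * ennreal (std_gaussian_density x) \<partial>lborel)
    \<le> ennreal (((norm \<Delta>)\<^sup>2 + 2 * \<sigma>\<^sup>2 * (CARD('d) + q - 2)) powr (q / 2))"
proof -
  define \<phi> where "\<phi> y = (norm (y - \<Delta>))\<^sup>2 / (2 * \<sigma>\<^sup>2)" for y
  define \<kappa> where "\<kappa> = (2 * pi) powr (- (CARD('d) / 2))"
  define E where "E x = exp (- (1 / 2) * (norm x)\<^sup>2)" for x :: "real ^ 'd"
  define C where "C = ((norm \<Delta>)\<^sup>2 + 2 * \<sigma>\<^sup>2 * (CARD('d) + q - 2)) powr (q / 2)"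
  have [measurable]: "\<phi> \<in> borel_measurable borel" "E \<in> borel_measurable borel"
    by (simp_all add: \<phi>_def[abs_def] E_def[abs_def])
  have growth: "- (norm \<Delta>)\<^sup>2 / (2 * \<sigma>\<^sup>2) + 1 / (4 * \<sigma>\<^sup>2) * (norm y)\<^sup>2 \<le> \<phi> y" for y
  proof -
    \<comment> \<open>This square equals 2 |y - \<Delta>|^2 - |y|^2 + 2 |\<Delta>|^2.\<close>
    have "0 \<le> (norm (y - 2 *\<^sub>R \<Delta>))\<^sup>2" by simp
    then have "- 2 * (norm \<Delta>)\<^sup>2 + (norm y)\<^sup>2 \<le> 2 * (norm (y - \<Delta>))\<^sup>2"
      by (simp add: power2_norm_eq_inner inner_diff_left inner_diff_right inner_commute)
    then have "(- 2 * (norm \<Delta>)\<^sup>2 + (norm y)\<^sup>2) / (4 * \<sigma>\<^sup>2) \<le> 2 * (norm (y - \<Delta>))\<^sup>2 / (4 * \<sigma>\<^sup>2)"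
      by (rule divide_right_mono) simp
    then show ?thesis by (simp add: \<phi>_def diff_divide_distrib)
  qed
  have sel: "is_selection 0 \<phi> (\<lambda>y. (y - \<Delta>) /\<^sub>R \<sigma>\<^sup>2)"
    unfolding is_selection_def subdifferential_def
  proof (intro allI CollectI)
    fix y z :: "real ^ 'd"
    have "0 \<le> (norm (z - y))\<^sup>2" by simp
    then have "(norm (y - \<Delta>))\<^sup>2 + 2 * ((y - \<Delta>) \<bullet> (z - y)) \<le> (norm (z - \<Delta>))\<^sup>2"
      by (simp add: power2_norm_eq_inner inner_diff_left inner_diff_right inner_commute)
    then have "((norm (y - \<Delta>))\<^sup>2 + 2 * ((y - \<Delta>) \<bullet> (z - y))) / (2 * \<sigma>\<^sup>2) \<le> (norm (z - \<Delta>))\<^sup>2 / (2 * \<sigma>\<^sup>2)"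
      by (rule divide_right_mono) simp
    moreover have "((y - \<Delta>) /\<^sub>R \<sigma>\<^sup>2) \<bullet> (z - y) = 2 * ((y - \<Delta>) \<bullet> (z - y)) / (2 * \<sigma>\<^sup>2)"
      by (simp only: inner_scaleR_left inverse_eq_divide mult_divide_mult_cancel_left zero_neq_numeral[symmetric]
          not_False_eq_True times_divide_eq_left mult_1)
    ultimately have "(norm (y - \<Delta>))\<^sup>2 / (2 * \<sigma>\<^sup>2) + ((y - \<Delta>) /\<^sub>R \<sigma>\<^sup>2) \<bullet> (z - y)
        \<le> (norm (z - \<Delta>))\<^sup>2 / (2 * \<sigma>\<^sup>2)"
      by (simp only: add_divide_distrib)
    then show "\<phi> y + ((y - \<Delta>) /\<^sub>R \<sigma>\<^sup>2) \<bullet> (z - y) - 0 / 2 * (norm (z - y))\<^sup>2 \<le> \<phi> z"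
      by (simp add: \<phi>_def del: inner_scaleR_left)
  qed
  \<comment> \<open>Splitting the cross term evenly makes b / \<alpha> equal to |\<Delta>|^2 in the
    notation of \<open>gibbs_weighted_moment_bound\<close>, hence the leading coefficient 1.\<close>
  have diss: "1 / (2 * \<sigma>\<^sup>2) * (norm y)\<^sup>2 - (norm \<Delta>)\<^sup>2 / (2 * \<sigma>\<^sup>2) \<le> ((y - \<Delta>) /\<^sub>R \<sigma>\<^sup>2) \<bullet> y" for y :: "real ^ 'd"
  proof -
    have "0 \<le> (norm (y - \<Delta>))\<^sup>2" by simp
    then have "(norm y)\<^sup>2 - (norm \<Delta>)\<^sup>2 \<le> 2 * ((y - \<Delta>) \<bullet> y)"
      by (simp add: power2_norm_eq_inner inner_diff_left inner_diff_right inner_commute)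
    then have "((norm y)\<^sup>2 - (norm \<Delta>)\<^sup>2) / (2 * \<sigma>\<^sup>2) \<le> 2 * ((y - \<Delta>) \<bullet> y) / (2 * \<sigma>\<^sup>2)"
      by (rule divide_right_mono) simp
    moreover have "((y - \<Delta>) /\<^sub>R \<sigma>\<^sup>2) \<bullet> y = 2 * ((y - \<Delta>) \<bullet> y) / (2 * \<sigma>\<^sup>2)"
      by (simp only: inner_scaleR_left inverse_eq_divide mult_divide_mult_cancel_left zero_neq_numeral[symmetric]
          not_False_eq_True times_divide_eq_left mult_1)
    ultimately show ?thesis by (simp del: inner_scaleR_left add: diff_divide_distrib)
  qed
  have \<phi>_scale: "exp (- \<phi> (\<Delta> + \<sigma> *\<^sub>R x)) = E x" for x
    using \<open>\<sigma> > 0\<close> by (simp add: \<phi>_def E_def power_mult_distrib)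
  have int: "integrable lborel (\<lambda>x. norm (\<Delta> + \<sigma> *\<^sub>R x) powr q * E x)"
  proof -
    have "integrable lborel (\<lambda>x. norm x powr q * exp (- \<phi> x))"
      using assms by (intro integrable_powr_mult_exp[OF _ growth]) auto
    then show ?thesis
      using integrable_lborel_scaleR[of "\<lambda>x. norm x powr q * exp (- \<phi> x)" \<sigma> \<Delta>] \<open>\<sigma> > 0\<close>
      by (simp add: \<phi>_scale)
  qed
  have b: "((norm \<Delta>)\<^sup>2 / (2 * \<sigma>\<^sup>2) + DIM(real ^ 'd) + q - 2) / (1 / (2 * \<sigma>\<^sup>2))
      = (norm \<Delta>)\<^sup>2 + 2 * \<sigma>\<^sup>2 * (CARD('d) + q - 2)"
    using \<open>\<sigma> > 0\<close> by (simp add: field_simps)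
  have "(\<integral>y. norm y powr q * exp (- \<phi> y) \<partial>lborel) \<le> C * (\<integral>y. exp (- \<phi> y) \<partial>lborel)"
    using gibbs_weighted_moment_bound[OF _ growth _ sel _ diss _ \<open>q \<ge> 2\<close>] \<open>\<sigma> > 0\<close> by (simp only: b C_def) simp
  also have "(\<integral>y. norm y powr q * exp (- \<phi> y) \<partial>lborel) =
      \<sigma> ^ CARD('d) * (\<integral>x. norm (\<Delta> + \<sigma> *\<^sub>R x) powr q * E x \<partial>lborel)"
    by (subst integral_lborel_scaleR[OF _ \<open>\<sigma> > 0\<close>, where t = \<Delta>]) (simp_all add: \<phi>_scale)
  also have "(\<integral>y. exp (- \<phi> y) \<partial>lborel) = \<sigma> ^ CARD('d) * (\<integral>x. E x \<partial>lborel)"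
    by (subst integral_lborel_scaleR[OF _ \<open>\<sigma> > 0\<close>, where t = \<Delta>]) (simp_all add: \<phi>_scale)
  also have "(\<integral>x. E x \<partial>lborel) = (2 * pi) powr (CARD('d) / 2)"
    using integral_gaussian_euclidean(2)[of "1 / 2", where 'a = "real ^ 'd"] by (simp add: E_def mult.commute)
  finally have "\<sigma> ^ CARD('d) * (\<kappa> * (\<integral>x. norm (\<Delta> + \<sigma> *\<^sub>R x) powr q * E x \<partial>lborel))
     \<le> \<sigma> ^ CARD('d) * (C * (\<kappa> * (2 * pi) powr (CARD('d) / 2)))"
    using \<open>\<sigma> > 0\<close> by (simp add: \<kappa>_def mult_le_cancel_left_pos)
  also have "\<kappa> * (2 * pi) powr (CARD('d) / 2) = 1"
    by (simp add: \<kappa>_def flip: powr_add)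
  finally have *: "\<kappa> * (\<integral>x. norm (\<Delta> + \<sigma> *\<^sub>R x) powr q * E x \<partial>lborel) \<le> C"
    using \<open>\<sigma> > 0\<close> by simp
  have "(\<integral>\<^sup>+x. ennreal (norm (\<Delta> + \<sigma> *\<^sub>R x) powr q) * ennreal (std_gaussian_density x) \<partial>lborel)
      = (\<integral>\<^sup>+x. ennreal (\<kappa> * (norm (\<Delta> + \<sigma> *\<^sub>R x) powr q * E x)) \<partial>lborel)"
    by (simp add: std_gaussian_density_eq ennreal_mult'[symmetric] \<kappa>_def E_def mult_ac)
  also have "\<dots> = ennreal (\<kappa> * (\<integral>x. norm (\<Delta> + \<sigma> *\<^sub>R x) powr q * E x \<partial>lborel))"
    using int by (subst nn_integral_eq_integral) (auto simp: \<kappa>_def E_def)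
  also have "\<dots> \<le> ennreal C" using * by (rule ennreal_leI)
  finally show ?thesis by (simp add: C_def)
qed

text \<open>Taming divides \<open>f\<close> by \<open>D\<close>, which is at least 1. The lower
  bound on the inner product of \<open>f\<close> and x is nonpositive, so it survives the division,
  and the untamed summand restores dissipativity with the same constants. In the square of the step,
  taming gives l |f / D|^2 at most 1 whatever the growth of \<open>h\<close>, and l \<mu> < 1/4 lets
  the linear summand use up only half of the contraction.\<close>

lemma tamed_drift_contraction:
  fixes h :: "'a::real_inner \<Rightarrow> 'a"
  assumes "\<mu> > 0" "0 < l" "l < 1 / (4 * \<mu>)" "b \<ge> 0"
    and diss: "\<mu> / 2 * (norm x)\<^sup>2 - b \<le> h x \<bullet> x"
  shows "(norm (x - l *\<^sub>R tamed_drift h \<mu> l x))\<^sup>2 \<le> (1 - l * \<mu> / 2) * (norm x)\<^sup>2 + 2 * l * (b + 1)"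
proof -
  define f where "f = h x - \<mu> *\<^sub>R x"
  define D where "D = 1 + sqrt l * norm f"
  define t where "t = tamed_drift h \<mu> l x"
  have "D \<ge> 1" using assms by (simp add: D_def)
  have t: "t = f /\<^sub>R D + \<mu> *\<^sub>R x" by (simp add: t_def tamed_drift_def f_def D_def)
  have fx: "- (\<mu> / 2 * (norm x)\<^sup>2 + b) \<le> f \<bullet> x"
    using diss by (simp add: f_def inner_diff_left power2_norm_eq_inner)
  have "- (\<mu> / 2 * (norm x)\<^sup>2 + b) \<le> (f /\<^sub>R D) \<bullet> x"
  proof -
    have "- (\<mu> / 2 * (norm x)\<^sup>2 + b) * D \<le> - (\<mu> / 2 * (norm x)\<^sup>2 + b) * 1"
    proof (rule mult_left_mono_neg)
      have "0 \<le> \<mu> / 2 * (norm x)\<^sup>2" using assms by simp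
      then show "- (\<mu> / 2 * (norm x)\<^sup>2 + b) \<le> 0" using assms by linarith
    qed fact
    also have "- (\<mu> / 2 * (norm x)\<^sup>2 + b) * 1 \<le> f \<bullet> x" using fx by simp
    finally have "- (\<mu> / 2 * (norm x)\<^sup>2 + b) * D \<le> f \<bullet> x" .
    then show ?thesis using \<open>D \<ge> 1\<close> by (simp add: field_simps)
  qed
  then have inner: "\<mu> / 2 * (norm x)\<^sup>2 - b \<le> t \<bullet> x"
    by (simp add: t inner_add_left power2_norm_eq_inner)
  have "sqrt l * norm (f /\<^sub>R D) \<le> 1"
    using \<open>D \<ge> 1\<close> by (simp add: D_def field_simps)
  then have "(sqrt l * norm (f /\<^sub>R D))\<^sup>2 \<le> 1"
    using assms by (simp add: power_le_one)
  then have taming: "l * (norm (f /\<^sub>R D))\<^sup>2 \<le> 1" using assms by (simp only: power_mult_distrib) simp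
  have "0 \<le> (norm (f /\<^sub>R D - \<mu> *\<^sub>R x))\<^sup>2" by simp
  then have "(norm t)\<^sup>2 \<le> 2 * (norm (f /\<^sub>R D))\<^sup>2 + 2 * (norm (\<mu> *\<^sub>R x))\<^sup>2"
    unfolding t power2_norm_eq_inner inner_add_left inner_add_right inner_diff_left inner_diff_right
    by (simp add: inner_commute)
  then have "(norm t)\<^sup>2 \<le> 2 * (norm (f /\<^sub>R D))\<^sup>2 + 2 * \<mu>\<^sup>2 * (norm x)\<^sup>2"
    by (simp add: power_mult_distrib)
  then have "l * (l * (norm t)\<^sup>2) \<le> l * (l * (2 * (norm (f /\<^sub>R D))\<^sup>2 + 2 * \<mu>\<^sup>2 * (norm x)\<^sup>2))"
    using assms by (intro mult_left_mono) auto
  also have "\<dots> = 2 * l * (l * (norm (f /\<^sub>R D))\<^sup>2) + 2 * l * \<mu> * (l * \<mu>) * (norm x)\<^sup>2"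
    by (simp add: algebra_simps power2_eq_square)
  also have "\<dots> \<le> 2 * l * 1 + 2 * l * \<mu> * (1 / 4) * (norm x)\<^sup>2"
    using taming assms by (intro add_mono mult_left_mono mult_right_mono) (auto simp: field_simps)
  finally have sq: "l\<^sup>2 * (norm t)\<^sup>2 \<le> 2 * l + l * \<mu> / 2 * (norm x)\<^sup>2"
    by (simp add: power2_eq_square mult_ac)
  have "(norm (x - l *\<^sub>R t))\<^sup>2 = (norm x)\<^sup>2 - 2 * (l * (t \<bullet> x)) + l\<^sup>2 * (norm t)\<^sup>2"
    unfolding power2_norm_eq_inner
    by (simp add: inner_diff_left inner_diff_right inner_commute algebra_simps power2_eq_square)
  also have "\<dots> \<le> (norm x)\<^sup>2 - 2 * (l * (\<mu> / 2 * (norm x)\<^sup>2 - b)) + (2 * l + l * \<mu> / 2 * (norm x)\<^sup>2)"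
    using inner sq assms by (intro add_mono diff_mono mult_left_mono) auto
  also have "\<dots> = (1 - l * \<mu> / 2) * (norm x)\<^sup>2 + 2 * l * (b + 1)" by (simp add: algebra_simps)
  finally show ?thesis by (simp add: t_def)
qed

section \<open>Comparison of the moment constants\<close>

lemma odd_fact_ge_1:
  assumes "p \<ge> 1"
  shows "odd_fact p \<ge> 1"
proof -
  have "(1 / 2 :: real) \<notin> \<int>\<^sub>\<le>\<^sub>0" using nonpos_Ints_nonpos[of "1 / 2 :: real"] by auto
  then have "sqrt pi / 2 = Gamma (3 / 2 :: real)"
    using Gamma_plus1[of "1 / 2 :: real"] 
    by (auto simp: Gamma_one_half_real)
  also have "\<dots> \<le> Gamma (p + 1 / 2)"
    using assms Gamma_real_strict_mono[of "3 / 2" "p + 1 / 2"] by (cases "p = 1") auto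
  finally have "2 * (sqrt pi / 2) \<le> 2 powr p * Gamma (p + 1 / 2)"
    using assms powr_mono[of 1 p "2::real"] by (intro mult_mono) auto
  then show ?thesis by (simp add: odd_fact_def field_simps)
qed

lemma Lambda_const_ge:
  assumes "p \<ge> 1"
  shows "Lambda_const p \<ge> 2 * p - 1"
proof -
  have "2 * p - 1 \<le> p * (p + 1) * 1 * 1"
    using zero_le_power2[of "p - 1"] assms by (simp add: power2_eq_square algebra_simps)
  also have "\<dots> \<le> p * (p + 1) * 2 powr (3 * p - 3) * sqrt (odd_fact p)"
    using assms odd_fact_ge_1[of p] by (intro mult_mono) (auto simp: ge_one_powr_ge_zero)
  finally show ?thesis by (simp add: Lambda_const_def)
qed

text \<open>The left side is the stationary level of the recursion in
  \<open>sg_tula_moment_step\<close>. As d is at least 1, the additive 2 p - 2 is absorbed by a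
  factor 2 p - 1, which \<open>Lambda_const\<close> dominates; the numerical factor 4 * 2 becomes 2
  powr (3 p).\<close>

lemma M_const_dominates:
  assumes "p \<ge> 1" "\<mu> > 0" "b \<ge> 0" "\<beta> > 0" "d \<ge> 1"
  shows "(4 / \<mu> * (1 + b + 2 * (d + 2 * p - 2) / \<beta>)) powr p
    \<le> M_const p * \<mu> powr (- p) * (1 + b + d / \<beta>) powr p"
proof -
  have "0 \<le> (2 * p - 2) * (d - 1)" using assms by (intro mult_nonneg_nonneg) auto
  then have 1: "d + 2 * p - 2 \<le> (2 * p - 1) * d" by (simp add: algebra_simps)
  have "1 + b + 2 * (d + 2 * p - 2) / \<beta> \<le> 2 * (2 * p - 1) * (1 + b) + 2 * ((2 * p - 1) * d) / \<beta>"
  proof (intro add_mono divide_right_mono mult_left_mono 1)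
    have "1 * (1 + b) \<le> 2 * (2 * p - 1) * (1 + b)" using assms by (intro mult_right_mono) auto
    then show "1 + b \<le> 2 * (2 * p - 1) * (1 + b)" by simp
  qed (use assms in auto)
  also have "\<dots> = 2 * (2 * p - 1) * (1 + b + d / \<beta>)"
    by (simp add: algebra_simps add_divide_distrib diff_divide_distrib)
  also have "\<dots> \<le> 2 * Lambda_const p * (1 + b + d / \<beta>)"
    using Lambda_const_ge[of p] assms by (intro mult_right_mono) auto
  finally have "4 / \<mu> * (1 + b + 2 * (d + 2 * p - 2) / \<beta>) \<le> 4 / \<mu> * (2 * Lambda_const p * (1 + b + d / \<beta>))"
    using assms by (intro mult_left_mono) auto
  then have "(4 / \<mu> * (1 + b + 2 * (d + 2 * p - 2) / \<beta>)) powr p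
      \<le> (4 / \<mu> * (2 * Lambda_const p * (1 + b + d / \<beta>))) powr p"
    using assms by (intro powr_mono2) auto
  also have "4 / \<mu> * (2 * Lambda_const p * (1 + b + d / \<beta>)) = 2 powr 3 * Lambda_const p * (1 / \<mu>) * (1 + b + d / \<beta>)"
    by simp
  also have "\<dots> powr p = 2 powr (3 * p) * Lambda_const p powr p * \<mu> powr (- p) * (1 + b + d / \<beta>) powr p"
    using assms Lambda_const_ge[of p] by (simp only: powr_mult powr_powr powr_one_eq_one powr_minus_divide powr_divide)
  also have "\<dots> \<le> M_const p * \<mu> powr (- p) * (1 + b + d / \<beta>) powr p"
    unfolding M_const_def by (intro mult_right_mono powr_mono) auto
  finally show ?thesis .
qed

section \<open>Moments of the iterates\<close>

lemma measurable_tamed_drift [measurable]: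
  fixes h :: "'a::euclidean_space \<Rightarrow> 'a"
  assumes [measurable]: "h \<in> borel_measurable borel"
  shows "tamed_drift h \<mu> l \<in> borel_measurable borel"
  unfolding tamed_drift_def[abs_def] by measurable

text \<open>For replaying the recursion on a product space: the two sample points may come from
  different spaces, and only the noises 1 to n have to agree.\<close>

lemma sg_tula_cong:
  assumes "\<theta>0 \<omega> = \<theta>0' \<omega>'" "\<And>k. 1 \<le> k \<Longrightarrow> k \<le> n \<Longrightarrow> \<xi> k \<omega> = \<xi>' k \<omega>'"
  shows "sg_tula h \<mu> \<beta> l \<theta>0 \<xi> n \<omega> = sg_tula h \<mu> \<beta> l \<theta>0' \<xi>' n \<omega>'"
  using assms(2) by (induction n) (simp_all add: assms(1))

text \<open>The measure \<open>N\<close> is arbitrary because this is applied both to the sample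
  space and to a product with coordinates 0 to n, where no later noise exists.\<close>

lemma measurable_sg_tula:
  fixes h :: "'a::euclidean_space \<Rightarrow> 'a"
  assumes [measurable]: "h \<in> borel_measurable borel" "\<theta>0 \<in> borel_measurable N"
    and \<xi>: "\<And>k. 1 \<le> k \<Longrightarrow> k \<le> n \<Longrightarrow> \<xi> k \<in> borel_measurable N"
  shows "sg_tula h \<mu> \<beta> l \<theta>0 \<xi> n \<in> borel_measurable N"
  using \<xi>
proof (induction n)
  case 0
  then show ?case by (simp add: sg_tula.simps(1)[abs_def] fun_eq_iff cong: measurable_cong)
next
  case (Suc n)
  then have [measurable]: "sg_tula h \<mu> \<beta> l \<theta>0 \<xi> n \<in> borel_measurable N" "\<xi> (Suc n) \<in> borel_measurable N"
    by auto
  have "(\<lambda>\<omega>. sg_tula h \<mu> \<beta> l \<theta>0 \<xi> n \<omega> - l *\<^sub>R tamed_drift h \<mu> l (sg_tula h \<mu> \<beta> l \<theta>0 \<xi> n \<omega>)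
         + sqrt (2 * l / \<beta>) *\<^sub>R \<xi> (Suc n) \<omega>) \<in> borel_measurable N" by measurable
  then show ?case by (simp flip: sg_tula.simps(2))
qed

lemma (in prob_space) indep_var_sg_tula:
  fixes h :: "'b::euclidean_space \<Rightarrow> 'b"
  assumes h: "h \<in> borel_measurable borel"
    and indep: "indep_vars (\<lambda>_. borel) (\<lambda>k. if k = 0 then \<theta>0 else \<xi> k) UNIV"
  shows "indep_var borel (sg_tula h \<mu> \<beta> l \<theta>0 \<xi> n) borel (\<xi> (Suc n))"
proof -
  let ?X = "\<lambda>k. if k = 0 then \<theta>0 else \<xi> k"
  \<comment> \<open>The recursion driven by coordinate projections: coordinate 0 is the start and
    coordinate k the k-th noise, matching the family \<open>?X\<close>. It exhibits the iterate as a
    function of a block of variables disjoint from the next noise.\<close>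
  let ?F = "\<lambda>z. sg_tula h \<mu> \<beta> l (\<lambda>z. z 0) (\<lambda>k z. z k) n (z :: nat \<Rightarrow> 'b)"
  have "indep_var borel (?F \<circ> (\<lambda>\<omega>. restrict (\<lambda>i. ?X i \<omega>) {..n}))
      borel ((\<lambda>z. z (Suc n)) \<circ> (\<lambda>\<omega>. restrict (\<lambda>i. ?X i \<omega>) {Suc n}))"
    by (rule indep_var_compose[OF indep_var_restrict[OF indep]])
       (auto intro!: measurable_sg_tula h measurable_component_singleton)
  also have "?F \<circ> (\<lambda>\<omega>. restrict (\<lambda>i. ?X i \<omega>) {..n}) = sg_tula h \<mu> \<beta> l \<theta>0 \<xi> n"
    by (rule ext, simp only: o_def, rule sg_tula_cong) auto
  also have "(\<lambda>z. z (Suc n)) \<circ> (\<lambda>\<omega>. restrict (\<lambda>i. ?X i \<omega>) {Suc n}) = \<xi> (Suc n)"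
    by (auto simp: fun_eq_iff)
  finally show ?thesis .
qed

lemma (in prob_space) nn_integral_indep_var_density:
  fixes X Y :: "'a \<Rightarrow> 'b::euclidean_space"
  assumes indep: "indep_var borel X borel Y"
    and Y: "distributed M lborel Y g"
    and [measurable]: "f \<in> borel_measurable (borel \<Otimes>\<^sub>M borel)"
  shows "(\<integral>\<^sup>+\<omega>. f (X \<omega>, Y \<omega>) \<partial>M) = (\<integral>\<^sup>+\<omega>. (\<integral>\<^sup>+y. g y * f (X \<omega>, y) \<partial>lborel) \<partial>M)"
proof -
  have [measurable]: "X \<in> borel_measurable M" "Y \<in> borel_measurable M"
    using indep by (auto dest: indep_var_rv1 indep_var_rv2)
  have [measurable]: "g \<in> borel_measurable borel" using Y by (simp add: distributed_def)
  have dY: "distr M borel Y = density lborel g"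
    using Y by (simp add: distributed_def cong: distr_cong)
  interpret X: prob_space "distr M borel X" by (rule prob_space_distr) simp
  interpret Y: prob_space "distr M borel Y" by (rule prob_space_distr) simp
  have "(\<integral>\<^sup>+\<omega>. f (X \<omega>, Y \<omega>) \<partial>M) = (\<integral>\<^sup>+z. f z \<partial>distr M (borel \<Otimes>\<^sub>M borel) (\<lambda>\<omega>. (X \<omega>, Y \<omega>)))"
    by (simp add: nn_integral_distr)
  also have "\<dots> = (\<integral>\<^sup>+z. f z \<partial>(distr M borel X \<Otimes>\<^sub>M distr M borel Y))"
    using indep by (simp add: indep_var_distribution_eq)
  also have "\<dots> = (\<integral>\<^sup>+x. (\<integral>\<^sup>+y. f (x, y) \<partial>distr M borel Y) \<partial>distr M borel X)"
    by (rule Y.nn_integral_fst[symmetric]) simp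
  also have "\<dots> = (\<integral>\<^sup>+\<omega>. (\<integral>\<^sup>+y. f (X \<omega>, y) \<partial>distr M borel Y) \<partial>M)"
    by (rule nn_integral_distr) auto
  also have "\<dots> = (\<integral>\<^sup>+\<omega>. (\<integral>\<^sup>+y. g y * f (X \<omega>, y) \<partial>lborel) \<partial>M)"
    unfolding dY by (intro nn_integral_cong nn_integral_density) auto
  finally show ?thesis .
qed

text \<open>Given the current iterate, the next one is a shifted Gaussian. Its moment bound, after
  the drift contraction, is a power of a convex combination of |x|^2 and a constant, and convexity
  of the power keeps the weights.\<close>

lemma (in prob_space) sg_tula_moment_step:
  fixes h :: "real ^ 'd \<Rightarrow> real ^ 'd" and p :: real
  assumes h[measurable]: "h \<in> borel_measurable borel"
    and diss: "\<And>x. \<mu> / 2 * (norm x)\<^sup>2 - b \<le> h x \<bullet> x"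
    and "\<mu> > 0" "b \<ge> 0" "0 < l" "l < 1 / (4 * \<mu>)" "\<beta> > 0" "p \<ge> 1"
    and indep: "indep_vars (\<lambda>_. borel) (\<lambda>k. if k = 0 then \<theta>0 else \<xi> k) UNIV"
    and gauss: "distributed M lborel (\<xi> (Suc n)) (\<lambda>x. ennreal (std_gaussian_density x))"
  shows "(\<integral>\<^sup>+\<omega>. ennreal (norm (sg_tula h \<mu> \<beta> l \<theta>0 \<xi> (Suc n) \<omega>) powr (2 * p)) \<partial>M)
    \<le> (\<integral>\<^sup>+\<omega>. ennreal ((1 - l * \<mu> / 2) * norm (sg_tula h \<mu> \<beta> l \<theta>0 \<xi> n \<omega>) powr (2 * p)
        + l * \<mu> / 2 * (4 / \<mu> * (1 + b + 2 * (CARD('d) + 2 * p - 2) / \<beta>)) powr p) \<partial>M)"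
proof -
  define \<sigma> where "\<sigma> = sqrt (2 * l / \<beta>)"
  define T where "T x = x - l *\<^sub>R tamed_drift h \<mu> l x" for x
  let ?\<theta> = "sg_tula h \<mu> \<beta> l \<theta>0 \<xi> n"
  have \<sigma>: "\<sigma> > 0" "\<sigma>\<^sup>2 = 2 * l / \<beta>" using assms by (auto simp: \<sigma>_def)
  have [measurable]: "T \<in> borel_measurable borel" unfolding T_def[abs_def] by measurable
  have "(\<integral>\<^sup>+\<omega>. ennreal (norm (sg_tula h \<mu> \<beta> l \<theta>0 \<xi> (Suc n) \<omega>) powr (2 * p)) \<partial>M)
      = (\<integral>\<^sup>+\<omega>. (\<lambda>(x, y). ennreal (norm (T x + \<sigma> *\<^sub>R y) powr (2 * p))) (?\<theta> \<omega>, \<xi> (Suc n) \<omega>) \<partial>M)"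
    by (simp add: T_def \<sigma>_def)
  also have "\<dots> = (\<integral>\<^sup>+\<omega>. (\<integral>\<^sup>+y. ennreal (std_gaussian_density y) *
      (\<lambda>(x, y). ennreal (norm (T x + \<sigma> *\<^sub>R y) powr (2 * p))) (?\<theta> \<omega>, y) \<partial>lborel) \<partial>M)"
    by (rule nn_integral_indep_var_density[OF indep_var_sg_tula[OF h indep] gauss]) measurable
  also have "\<dots> \<le> (\<integral>\<^sup>+\<omega>. ennreal ((1 - l * \<mu> / 2) * norm (?\<theta> \<omega>) powr (2 * p)
        + l * \<mu> / 2 * (4 / \<mu> * (1 + b + 2 * (CARD('d) + 2 * p - 2) / \<beta>)) powr p) \<partial>M)"
  proof (rule nn_integral_mono)
    fix \<omega>
    define x where "x = ?\<theta> \<omega>"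
    define \<kappa> where "\<kappa> = l * \<mu> / 2"
    \<comment> \<open>Chosen so that \<open>\<kappa> * c\<close> is the drift constant 2 l (b + 1)
      plus the noise term; dividing by l \<mu> / 2 produces the factor 4 / \<mu>.\<close>
    define c where "c = 4 / \<mu> * (1 + b + 2 * (CARD('d) + 2 * p - 2) / \<beta>)"
    have \<kappa>: "0 \<le> \<kappa>" "\<kappa> \<le> 1" using assms by (auto simp: \<kappa>_def field_simps)
    have "c \<ge> 0" using assms by (simp add: c_def)
    have pow: "((norm x)\<^sup>2) powr p = norm x powr (2 * p)"
      by (simp add: powr_powr flip: powr_numeral)
    have "(norm (T x))\<^sup>2 + 2 * \<sigma>\<^sup>2 * (CARD('d) + 2 * p - 2)
        \<le> (1 - l * \<mu> / 2) * (norm x)\<^sup>2 + 2 * l * (b + 1) + 2 * \<sigma>\<^sup>2 * (CARD('d) + 2 * p - 2)"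
      using assms unfolding T_def by (intro add_right_mono tamed_drift_contraction) auto
    also have "\<dots> = (1 - \<kappa>) * (norm x)\<^sup>2 + \<kappa> * c"
      using \<open>\<mu> > 0\<close> \<open>\<beta> > 0\<close> by (simp add: \<kappa>_def c_def \<sigma>(2) field_simps)
    finally have "((norm (T x))\<^sup>2 + 2 * \<sigma>\<^sup>2 * (CARD('d) + 2 * p - 2)) powr p
       \<le> ((1 - \<kappa>) * (norm x)\<^sup>2 + \<kappa> * c) powr p"
      using assms by (intro powr_mono2) auto
    also have "\<dots> \<le> (1 - \<kappa>) * ((norm x)\<^sup>2) powr p + \<kappa> * c powr p"
      using \<kappa> \<open>c \<ge> 0\<close> \<open>p \<ge> 1\<close> by (intro powr_convex_combination) auto
    finally have *: "((norm (T x))\<^sup>2 + 2 * \<sigma>\<^sup>2 * (CARD('d) + 2 * p - 2)) powr p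
       \<le> (1 - \<kappa>) * norm x powr (2 * p) + \<kappa> * c powr p"
      by (simp add: pow)
    have "(\<integral>\<^sup>+y. ennreal (std_gaussian_density y) * ennreal (norm (T x + \<sigma> *\<^sub>R y) powr (2 * p)) \<partial>lborel)
       \<le> ennreal (((norm (T x))\<^sup>2 + 2 * \<sigma>\<^sup>2 * (CARD('d) + 2 * p - 2)) powr p)"
      using gaussian_shift_moment_bound[OF \<sigma>(1), of "2 * p" "T x"] \<open>p \<ge> 1\<close> by (simp add: mult.commute)
    also have "\<dots> \<le> ennreal ((1 - \<kappa>) * norm x powr (2 * p) + \<kappa> * c powr p)"
      using * by (rule ennreal_leI)
    finally show "(\<integral>\<^sup>+y. ennreal (std_gaussian_density y) *
        (\<lambda>(x, y). ennreal (norm (T x + \<sigma> *\<^sub>R y) powr (2 * p))) (?\<theta> \<omega>, y) \<partial>lborel)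
      \<le> ennreal ((1 - l * \<mu> / 2) * norm (?\<theta> \<omega>) powr (2 * p)
        + l * \<mu> / 2 * (4 / \<mu> * (1 + b + 2 * (CARD('d) + 2 * p - 2) / \<beta>)) powr p)"
      by (simp add: x_def \<kappa>_def c_def)
  qed
  finally show ?thesis .
qed

lemma (in prob_space) sg_tula_moment_bound:
  fixes h :: "real ^ 'd \<Rightarrow> real ^ 'd" and p :: real
  assumes h: "h \<in> borel_measurable borel"
    and diss: "\<And>x. \<mu> / 2 * (norm x)\<^sup>2 - b \<le> h x \<bullet> x"
    and pos: "\<mu> > 0" "b \<ge> 0" "0 < l" "l < 1 / (4 * \<mu>)" "\<beta> > 0" "p \<ge> 1"
    and indep: "indep_vars (\<lambda>_. borel) (\<lambda>k. if k = 0 then \<theta>0 else \<xi> k) UNIV"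
    and gauss: "\<And>k. k \<ge> 1 \<Longrightarrow> distributed M lborel (\<xi> k) (\<lambda>x. ennreal (std_gaussian_density x))"
    and \<theta>0: "\<theta>0 \<in> borel_measurable M" "integrable M (\<lambda>\<omega>. norm (\<theta>0 \<omega>) powr (2 * p))"
  shows "integrable M (\<lambda>\<omega>. norm (sg_tula h \<mu> \<beta> l \<theta>0 \<xi> n \<omega>) powr (2 * p)) \<and>
    (\<integral>\<omega>. norm (sg_tula h \<mu> \<beta> l \<theta>0 \<xi> n \<omega>) powr (2 * p) \<partial>M) \<le>
      CB2 (\<integral>\<omega>. norm (\<theta>0 \<omega>) powr (2 * p) \<partial>M) p \<mu> b \<beta> (real CARD('d))"
proof -
  define c where "c = (4 / \<mu> * (1 + b + 2 * (CARD('d) + 2 * p - 2) / \<beta>)) powr p"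
  define E where "E = (\<integral>\<omega>. norm (\<theta>0 \<omega>) powr (2 * p) \<partial>M)"
  have meas: "sg_tula h \<mu> \<beta> l \<theta>0 \<xi> n \<in> borel_measurable M" for n
  proof (rule measurable_sg_tula[OF h \<theta>0(1)])
    fix k :: nat assume "1 \<le> k"
    from gauss[OF this] show "\<xi> k \<in> borel_measurable M" by (simp add: distributed_def)
  qed
  have "E \<ge> 0" "c \<ge> 0" by (auto simp: E_def c_def)
  have \<kappa>: "0 \<le> l * \<mu> / 2" "l * \<mu> / 2 \<le> 1" using pos by (auto simp: field_simps)
  \<comment> \<open>\<open>E + c\<close> is invariant because each step averages the previous moment
    with \<open>c\<close>.\<close>
  have "integrable M (\<lambda>\<omega>. norm (sg_tula h \<mu> \<beta> l \<theta>0 \<xi> n \<omega>) powr (2 * p)) \<and>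
    (\<integral>\<omega>. norm (sg_tula h \<mu> \<beta> l \<theta>0 \<xi> n \<omega>) powr (2 * p) \<partial>M) \<le> E + c"
  proof (induction n)
    case 0
    then show ?case using \<theta>0 \<open>c \<ge> 0\<close> by (simp add: E_def)
  next
    case (Suc n)
    let ?X = "\<lambda>n \<omega>. norm (sg_tula h \<mu> \<beta> l \<theta>0 \<xi> n \<omega>) powr (2 * p)"
    have int: "integrable M (?X n)" and le: "(\<integral>\<omega>. ?X n \<omega> \<partial>M) \<le> E + c" using Suc by auto
    have [measurable]: "?X (Suc n) \<in> borel_measurable M" using meas[of "Suc n"] by measurable
    have int': "integrable M (\<lambda>\<omega>. (1 - l * \<mu> / 2) * ?X n \<omega> + l * \<mu> / 2 * c)"
      by (intro Bochner_Integration.integrable_add integrable_mult_right int) simp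
    \<comment> \<open>The bound is first obtained in the extended nonnegative reals, where it also
      yields integrability of the next moment.\<close>
    have "(\<integral>\<^sup>+\<omega>. ennreal (?X (Suc n) \<omega>) \<partial>M) \<le> (\<integral>\<^sup>+\<omega>. ennreal ((1 - l * \<mu> / 2) * ?X n \<omega> + l * \<mu> / 2 * c) \<partial>M)"
      using sg_tula_moment_step[OF h diss pos indep gauss[of "Suc n"]] by (simp add: c_def)
    also have "\<dots> = ennreal (\<integral>\<omega>. (1 - l * \<mu> / 2) * ?X n \<omega> + l * \<mu> / 2 * c \<partial>M)"
      using int' \<kappa> \<open>c \<ge> 0\<close> by (intro nn_integral_eq_integral) auto
    also have "(\<integral>\<omega>. (1 - l * \<mu> / 2) * ?X n \<omega> + l * \<mu> / 2 * c \<partial>M) =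
        (1 - l * \<mu> / 2) * (\<integral>\<omega>. ?X n \<omega> \<partial>M) + l * \<mu> / 2 * c"
      using int by (subst Bochner_Integration.integral_add) (auto simp: prob_space)
    also have "\<dots> \<le> (1 - l * \<mu> / 2) * (E + c) + l * \<mu> / 2 * (E + c)"
      using le \<kappa> \<open>E \<ge> 0\<close> by (intro add_mono mult_left_mono) auto
    also have "\<dots> = E + c" by (simp add: algebra_simps)
    finally have nn: "(\<integral>\<^sup>+\<omega>. ennreal (?X (Suc n) \<omega>) \<partial>M) \<le> ennreal (E + c)"
      by (auto simp: ennreal_leI)
    then have "integrable M (?X (Suc n))"
      by (intro integrableI_nonneg) (auto simp del: sg_tula.simps intro: le_less_trans)
    moreover from this nn have "(\<integral>\<omega>. ?X (Suc n) \<omega> \<partial>M) \<le> E + c"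
      using \<open>E \<ge> 0\<close> \<open>c \<ge> 0\<close> by (subst (asm) nn_integral_eq_integral) (auto simp del: sg_tula.simps ennreal_plus)
    ultimately show ?case by blast
  qed
  moreover have "E + c \<le> CB2 E p \<mu> b \<beta> (real CARD('d))"
    using M_const_dominates[of p \<mu> b \<beta> "real CARD('d)"] pos by (simp add: CB2_def c_def)
  ultimately show ?thesis by (auto simp: E_def)
qed

section \<open>Wasserstein distance\<close>

lemma ennreal_power2_le_imp_le:
  fixes x :: ennreal
  assumes "x\<^sup>2 \<le> ennreal (a\<^sup>2)" "a \<ge> 0"
  shows "x \<le> ennreal a"
proof (cases x)
  case (real r)
  then have "r\<^sup>2 \<le> a\<^sup>2" using assms by (simp add: ennreal_power)
  then have "r \<le> a" using assms(2) by (rule power2_le_imp_le)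
  then show ?thesis using real by (simp add: ennreal_leI)
next
  case top
  then show ?thesis using assms(1) by (simp add: power2_eq_square ennreal_mult_top top_unique)
qed

lemma nn_integral_Cauchy_Schwarz_bound:
  fixes f g :: "'a \<Rightarrow> real"
  assumes [measurable]: "f \<in> borel_measurable M" "g \<in> borel_measurable M"
    and nonneg: "\<And>x. 0 \<le> f x" "\<And>x. 0 \<le> g x"
    and f: "(\<integral>\<^sup>+x. ennreal ((f x)\<^sup>2) \<partial>M) \<le> ennreal a" "0 \<le> a"
    and g: "(\<integral>\<^sup>+x. ennreal ((g x)\<^sup>2) \<partial>M) \<le> ennreal c" "0 \<le> c"
  shows "(\<integral>\<^sup>+x. ennreal (f x * g x) \<partial>M) \<le> ennreal (sqrt a * sqrt c)"
proof (rule ennreal_power2_le_imp_le)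
  have "(\<integral>\<^sup>+x. ennreal (f x * g x) \<partial>M)\<^sup>2 \<le>
      (\<integral>\<^sup>+x. ennreal ((f x)\<^sup>2) \<partial>M) * (\<integral>\<^sup>+x. ennreal ((g x)\<^sup>2) \<partial>M)"
    using Cauchy_Schwarz_nn_integral[of "\<lambda>x. ennreal (f x)" M "\<lambda>x. ennreal (g x)"] nonneg
    by (simp add: ennreal_mult ennreal_power)
  also have "\<dots> \<le> ennreal a * ennreal c" using f g by (intro mult_mono) auto
  also have "\<dots> = ennreal ((sqrt a * sqrt c)\<^sup>2)"
    using f g by (simp add: power_mult_distrib ennreal_mult)
  finally show "(\<integral>\<^sup>+x. ennreal (f x * g x) \<partial>M)\<^sup>2 \<le> ennreal ((sqrt a * sqrt c)\<^sup>2)" .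
qed (use f g in auto)

lemma couplingsD:
  fixes P Q :: "'a::euclidean_space measure"
  assumes "C \<in> couplings P Q"
  shows "prob_space C" "fst \<in> borel_measurable C" "snd \<in> borel_measurable C"
    "P = distr C borel fst" "Q = distr C borel snd"
proof -
  have [measurable_cong]: "sets C = sets (borel \<Otimes>\<^sub>M borel)" using assms by (auto simp: couplings_def)
  show "fst \<in> borel_measurable C" "snd \<in> borel_measurable C" by measurable
qed (use assms in \<open>auto simp: couplings_def\<close>)

lemma pair_measure_in_couplings:
  fixes P Q :: "'a::euclidean_space measure"
  assumes P: "prob_space P" "sets P = sets borel" and Q: "prob_space Q" "sets Q = sets borel"
  shows "P \<Otimes>\<^sub>M Q \<in> couplings P Q"
proof -
  interpret P: prob_space P by fact
  interpret Q: prob_space Q by fact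
  interpret PQ: pair_prob_space P Q ..
  have "distr (P \<Otimes>\<^sub>M Q) borel fst = distr (P \<Otimes>\<^sub>M Q) P fst"
    using P by (intro distr_cong) auto
  also have "\<dots> = P" by (rule Q.distr_pair_fst)
  finally have 1: "distr (P \<Otimes>\<^sub>M Q) borel fst = P" .
  have "distr (P \<Otimes>\<^sub>M Q) borel snd = distr (P \<Otimes>\<^sub>M Q) Q snd"
    using Q by (intro distr_cong) auto
  also have "\<dots> = distr (distr (Q \<Otimes>\<^sub>M P) (P \<Otimes>\<^sub>M Q) (\<lambda>(x, y). (y, x))) Q snd"
    by (subst PQ.distr_pair_swap) simp
  also have "\<dots> = distr (Q \<Otimes>\<^sub>M P) Q fst"
    by (subst distr_distr) (auto simp: o_def split_beta' intro!: distr_cong)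
  also have "\<dots> = Q" by (rule P.distr_pair_fst)
  finally have 2: "distr (P \<Otimes>\<^sub>M Q) borel snd = Q" .
  have "sets (P \<Otimes>\<^sub>M Q) = sets (borel \<Otimes>\<^sub>M borel)"
    using P Q by (intro sets_pair_measure_cong) auto
  with 1 2 PQ.prob_space_axioms show ?thesis by (simp add: couplings_def)
qed

text \<open>An infimum is bounded below coupling by coupling, so no optimal one has to exist. A
  coupling of finite cost is required because \<open>enn2real\<close> sends infinity to 0.
  Nonpositive \<open>X\<close> is treated apart since squares are compared.\<close>

lemma le_wasserstein2I:
  fixes P Q :: "'a::euclidean_space measure"
  assumes "K > 0"
    and bound: "\<And>C s. C \<in> couplings P Q \<Longrightarrow> 0 \<le> s \<Longrightarrow>
      (\<integral>\<^sup>+z. ennreal ((dist (fst z) (snd z))\<^sup>2) \<partial>C) \<le> ennreal s \<Longrightarrow> X \<le> K * sqrt s"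
    and finite: "C0 \<in> couplings P Q" "(\<integral>\<^sup>+z. ennreal ((dist (fst z) (snd z))\<^sup>2) \<partial>C0) < \<infinity>"
  shows "X \<le> K * wasserstein2 P Q"
proof (cases "X \<le> 0")
  case True
  then show ?thesis using \<open>K > 0\<close> by (smt (verit) enn2real_nonneg mult_nonneg_nonneg real_sqrt_ge_zero wasserstein2_def)
next
  case False
  let ?cost = "\<lambda>C. \<integral>\<^sup>+z. ennreal ((dist (fst z) (snd z))\<^sup>2) \<partial>C"
  define I where "I = (INF C\<in>couplings P Q. ?cost C)"
  have "I \<le> ?cost C0" unfolding I_def using finite(1) by (rule INF_lower)
  then have "I < \<infinity>" using finite(2) by (rule le_less_trans)
  have "ennreal ((X / K)\<^sup>2) \<le> I"
    unfolding I_def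
  proof (rule INF_greatest)
    fix C assume C: "C \<in> couplings P Q"
    show "ennreal ((X / K)\<^sup>2) \<le> ?cost C"
    proof (cases "?cost C")
      case (real s)
      then have "X / K \<le> sqrt s" using bound[OF C, of s] \<open>K > 0\<close> by (simp add: field_simps)
      then have "(X / K)\<^sup>2 \<le> (sqrt s)\<^sup>2" using False \<open>K > 0\<close> by (intro power_mono) auto
      then show ?thesis using real by (simp add: ennreal_leI)
    qed simp
  qed
  then have "(X / K)\<^sup>2 \<le> enn2real I"
    using enn2real_mono[of "ennreal ((X / K)\<^sup>2)" I] \<open>I < \<infinity>\<close> by simp
  then have "X / K \<le> sqrt (enn2real I)" by (rule real_le_rsqrt)
  then show ?thesis using \<open>K > 0\<close> by (simp add: wasserstein2_def I_def field_simps)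
qed

lemma powr_le_one_plus_powr:
  fixes t r s :: real
  assumes "0 \<le> t" "0 \<le> r" "r \<le> s"
  shows "t powr r \<le> 1 + t powr s"
proof (cases "t \<le> 1")
  case True
  then have "t powr r \<le> 1" using assms by (simp add: powr_le1)
  then show ?thesis by (smt (verit) powr_ge_zero)
next
  case False
  then have "t powr r \<le> t powr s" using assms by (intro powr_mono) auto
  then show ?thesis by simp
qed

lemma expectation_difference_le_wasserstein2:
  fixes P Q :: "'a::euclidean_space measure" and u :: "'a \<Rightarrow> real"
  assumes P: "prob_space P" "sets P = sets borel" and Q: "prob_space Q" "sets Q = sets borel"
    and incr: "\<And>x y. u x - u y \<le> norm (x - y) * (m + k * (norm x powr p + norm y powr p))"
    and "m > 0" "k \<ge> 0" "p \<ge> 1"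
    and uP: "integrable P u" and uQ: "integrable Q u"
    and mP: "integrable P (\<lambda>x. norm x powr (2 * p))" "(\<integral>x. norm x powr (2 * p) \<partial>P) \<le> A"
    and mQ: "integrable Q (\<lambda>x. norm x powr (2 * p))" "(\<integral>x. norm x powr (2 * p) \<partial>Q) \<le> B"
  shows "(\<integral>x. u x \<partial>Q) - (\<integral>x. u x \<partial>P) \<le> (m + k * (sqrt B + sqrt A)) * wasserstein2 P Q"
proof -
  have "0 \<le> (\<integral>x. norm x powr (2 * p) \<partial>P)" "0 \<le> (\<integral>x. norm x powr (2 * p) \<partial>Q)" by auto
  then have AB: "0 \<le> A" "0 \<le> B" using mP(2) mQ(2) by linarith+
  have sq: "(t powr p)\<^sup>2 = t powr (2 * p)" for t :: real
    by (simp add: power2_eq_square flip: powr_add)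
  show ?thesis
  proof (rule le_wasserstein2I)
    show "0 < m + k * (sqrt B + sqrt A)" using AB \<open>m > 0\<close> \<open>k \<ge> 0\<close> by (intro add_pos_nonneg mult_nonneg_nonneg) auto
  next
    fix C s
    assume C: "C \<in> couplings P Q" and s: "0 \<le> s" "(\<integral>\<^sup>+z. ennreal ((dist (fst z) (snd z))\<^sup>2) \<partial>C) \<le> ennreal s"
    interpret C: prob_space C using couplingsD[OF C] by simp
    have [measurable]: "fst \<in> borel_measurable C" "snd \<in> borel_measurable C" using couplingsD[OF C] by auto
    have PC: "P = distr C borel fst" and QC: "Q = distr C borel snd" using couplingsD[OF C] by auto
    have [measurable]: "u \<in> borel_measurable borel" using borel_measurable_integrable[OF uP] P(2) by (simp cong: measurable_cong_sets)
    define D where "D z = dist (fst z) (snd z)" for z :: "'a \<times> 'a"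
    have [measurable]: "D \<in> borel_measurable C" unfolding D_def[abs_def] by measurable
    have uC: "integrable C (\<lambda>z. u (fst z))" "integrable C (\<lambda>z. u (snd z))"
      using uP uQ by (auto simp: PC QC integrable_distr_eq)
    have mom: "(\<integral>\<^sup>+z. ennreal ((norm (fst z) powr p)\<^sup>2) \<partial>C) \<le> ennreal A"
       "(\<integral>\<^sup>+z. ennreal ((norm (snd z) powr p)\<^sup>2) \<partial>C) \<le> ennreal B"
    proof -
      have "(\<integral>\<^sup>+z. ennreal ((norm (fst z) powr p)\<^sup>2) \<partial>C) = (\<integral>\<^sup>+x. ennreal (norm x powr (2 * p)) \<partial>P)"
        unfolding PC by (subst nn_integral_distr) (auto simp: sq)
      also have "\<dots> \<le> ennreal A" using mP by (subst nn_integral_eq_integral) (auto intro: ennreal_leI)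
      finally show "(\<integral>\<^sup>+z. ennreal ((norm (fst z) powr p)\<^sup>2) \<partial>C) \<le> ennreal A" .
      have "(\<integral>\<^sup>+z. ennreal ((norm (snd z) powr p)\<^sup>2) \<partial>C) = (\<integral>\<^sup>+x. ennreal (norm x powr (2 * p)) \<partial>Q)"
        unfolding QC by (subst nn_integral_distr) (auto simp: sq)
      also have "\<dots> \<le> ennreal B" using mQ by (subst nn_integral_eq_integral) (auto intro: ennreal_leI)
      finally show "(\<integral>\<^sup>+z. ennreal ((norm (snd z) powr p)\<^sup>2) \<partial>C) \<le> ennreal B" .
    qed
    have D2: "(\<integral>\<^sup>+z. ennreal ((D z)\<^sup>2) \<partial>C) \<le> ennreal s" using s by (simp add: D_def)
    \<comment> \<open>The second factor in the Cauchy-Schwarz inequality for the summand with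
      \<open>m\<close>.\<close>
    have one: "(\<integral>\<^sup>+z. ennreal (1\<^sup>2) \<partial>C) \<le> ennreal 1" by (simp add: C.emeasure_space_1)
    note CS = nn_integral_Cauchy_Schwarz_bound[where M = C and g = D, OF _ _ _ _ _ _ D2 s(1)]
    have cs0: "(\<integral>\<^sup>+z. ennreal (D z) \<partial>C) \<le> ennreal (sqrt s)"
      using CS[OF _ _ _ _ one] by (simp add: D_def)
    have cs1: "(\<integral>\<^sup>+z. ennreal (norm (fst z) powr p * D z) \<partial>C) \<le> ennreal (sqrt A * sqrt s)"
      using CS[OF _ _ _ _ mom(1)] AB by (simp add: D_def)
    have cs2: "(\<integral>\<^sup>+z. ennreal (norm (snd z) powr p * D z) \<partial>C) \<le> ennreal (sqrt B * sqrt s)"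
      using CS[OF _ _ _ _ mom(2)] AB by (simp add: D_def)
    define f where "f z = u (snd z) - u (fst z)" for z
    have f: "integrable C f" unfolding f_def[abs_def] using uC by (intro Bochner_Integration.integrable_diff)
    have "(\<integral>x. u x \<partial>Q) - (\<integral>x. u x \<partial>P) = (\<integral>z. f z \<partial>C)"
      using uC by (simp add: PC QC integral_distr f_def Bochner_Integration.integral_diff)
    \<comment> \<open>The increment bound is one-sided, so only the positive part of
      \<open>f\<close> can be passed to nonnegative integrals.\<close>
    also have "\<dots> \<le> (\<integral>z. max 0 (f z) \<partial>C)" using f by (intro integral_mono) auto
    also have "\<dots> \<le> (m + k * (sqrt B + sqrt A)) * sqrt s"
    proof -
      have "ennreal (\<integral>z. max 0 (f z) \<partial>C) = (\<integral>\<^sup>+z. ennreal (max 0 (f z)) \<partial>C)"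
        using f by (intro nn_integral_eq_integral[symmetric]) auto
      also have "\<dots> \<le> (\<integral>\<^sup>+z. ennreal m * ennreal (D z) + ennreal k * (ennreal (norm (snd z) powr p * D z)
          + ennreal (norm (fst z) powr p * D z)) \<partial>C)"
      proof (rule nn_integral_mono)
        fix z
        have "D z * (m + k * (norm (snd z) powr p + norm (fst z) powr p)) \<ge> 0"
          using \<open>m > 0\<close> \<open>k \<ge> 0\<close> by (auto simp: D_def intro!: mult_nonneg_nonneg add_nonneg_nonneg)
        moreover have "f z \<le> D z * (m + k * (norm (snd z) powr p + norm (fst z) powr p))"
          using incr[of "snd z" "fst z"] by (simp add: f_def D_def dist_norm norm_minus_commute)
        ultimately have "max 0 (f z) \<le> m * D z + k * (norm (snd z) powr p * D z + norm (fst z) powr p * D z)"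
          by (simp add: algebra_simps)
        then show "ennreal (max 0 (f z)) \<le> ennreal m * ennreal (D z) + ennreal k * (ennreal (norm (snd z) powr p * D z)
          + ennreal (norm (fst z) powr p * D z))"
          using \<open>m > 0\<close> \<open>k \<ge> 0\<close> by (simp add: D_def ennreal_leI flip: ennreal_mult' ennreal_plus)
      qed
      also have "\<dots> = ennreal m * (\<integral>\<^sup>+z. ennreal (D z) \<partial>C) + ennreal k * ((\<integral>\<^sup>+z. ennreal (norm (snd z) powr p * D z) \<partial>C)
          + (\<integral>\<^sup>+z. ennreal (norm (fst z) powr p * D z) \<partial>C))"
        by (simp add: nn_integral_add nn_integral_cmult)
      also have "\<dots> \<le> ennreal m * ennreal (sqrt s) + ennreal k * (ennreal (sqrt B * sqrt s) + ennreal (sqrt A * sqrt s))"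
        by (intro add_mono mult_left_mono cs0 cs1 cs2) auto
      also have "\<dots> = ennreal ((m + k * (sqrt B + sqrt A)) * sqrt s)"
        using \<open>m > 0\<close> \<open>k \<ge> 0\<close> AB s(1)
        by (simp add: algebra_simps flip: ennreal_mult' ennreal_plus)
      finally show ?thesis
        using \<open>m > 0\<close> \<open>k \<ge> 0\<close> AB s(1) by (subst (asm) ennreal_le_iff) auto
    qed
    finally show "(\<integral>x. u x \<partial>Q) - (\<integral>x. u x \<partial>P) \<le> (m + k * (sqrt B + sqrt A)) * sqrt s" .
  next
    \<comment> \<open>The product coupling has finite cost, because both measures have moments of
      order 2 p, which is at least 2.\<close>
    show C0: "P \<Otimes>\<^sub>M Q \<in> couplings P Q" by (rule pair_measure_in_couplings) fact+
    have [measurable]: "fst \<in> borel_measurable (P \<Otimes>\<^sub>M Q)" "snd \<in> borel_measurable (P \<Otimes>\<^sub>M Q)"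
      using couplingsD[OF C0] by auto
    have *: "(\<integral>\<^sup>+x. ennreal ((norm x)\<^sup>2) \<partial>N) < \<infinity>"
      if N: "prob_space N" "sets N = sets borel" "integrable N (\<lambda>x. norm x powr (2 * p))" for N :: "'a measure"
    proof -
      interpret N: prob_space N by fact
      have "(\<integral>\<^sup>+x. ennreal ((norm x)\<^sup>2) \<partial>N) \<le> (\<integral>\<^sup>+x. ennreal (1 + norm x powr (2 * p)) \<partial>N)"
      proof (intro nn_integral_mono ennreal_leI)
        fix x :: 'a
        show "(norm x)\<^sup>2 \<le> 1 + norm x powr (2 * p)"
          using powr_le_one_plus_powr[of "norm x" 2 "2 * p"] \<open>p \<ge> 1\<close> by simp
      qed
      also have "\<dots> < \<infinity>"
        using N(3) by (subst nn_integral_eq_integral) auto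
      finally show ?thesis .
    qed
    have "(\<integral>\<^sup>+z. ennreal ((dist (fst z) (snd z))\<^sup>2) \<partial>(P \<Otimes>\<^sub>M Q)) \<le>
        (\<integral>\<^sup>+z. 2 * ennreal ((norm (fst z))\<^sup>2) + 2 * ennreal ((norm (snd z))\<^sup>2) \<partial>(P \<Otimes>\<^sub>M Q))"
    proof (rule nn_integral_mono)
      fix z :: "'a \<times> 'a"
      have "0 \<le> (norm (fst z + snd z))\<^sup>2" by simp
      then have "(dist (fst z) (snd z))\<^sup>2 \<le> 2 * (norm (fst z))\<^sup>2 + 2 * (norm (snd z))\<^sup>2"
        unfolding dist_norm power2_norm_eq_inner
        by (simp add: inner_add_left inner_add_right inner_diff_left inner_diff_right inner_commute)
      then have "ennreal ((dist (fst z) (snd z))\<^sup>2) \<le> ennreal (2 * (norm (fst z))\<^sup>2 + 2 * (norm (snd z))\<^sup>2)"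
        by (rule ennreal_leI)
      then show "ennreal ((dist (fst z) (snd z))\<^sup>2) \<le> 2 * ennreal ((norm (fst z))\<^sup>2) + 2 * ennreal ((norm (snd z))\<^sup>2)"
        by (simp add: ennreal_mult)
    qed
    also have "\<dots> = 2 * (\<integral>\<^sup>+z. ennreal ((norm (fst z))\<^sup>2) \<partial>(P \<Otimes>\<^sub>M Q)) + 2 * (\<integral>\<^sup>+z. ennreal ((norm (snd z))\<^sup>2) \<partial>(P \<Otimes>\<^sub>M Q))"
      by (simp add: nn_integral_add nn_integral_cmult)
    also have "(\<integral>\<^sup>+z. ennreal ((norm (fst z))\<^sup>2) \<partial>(P \<Otimes>\<^sub>M Q)) = (\<integral>\<^sup>+x. ennreal ((norm x)\<^sup>2) \<partial>P)"
      by (subst (2) couplingsD(4)[OF C0], subst nn_integral_distr) auto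
    also have "(\<integral>\<^sup>+z. ennreal ((norm (snd z))\<^sup>2) \<partial>(P \<Otimes>\<^sub>M Q)) = (\<integral>\<^sup>+x. ennreal ((norm x)\<^sup>2) \<partial>Q)"
      by (subst (2) couplingsD(5)[OF C0], subst nn_integral_distr) auto
    finally show "(\<integral>\<^sup>+z. ennreal ((dist (fst z) (snd z))\<^sup>2) \<partial>(P \<Otimes>\<^sub>M Q)) < \<infinity>"
      using *[OF P mP(1)] *[OF Q mQ(1)] by (auto simp: ennreal_mult_less_top elim!: le_less_trans)
  qed
qed

section \<open>Entropy and the partition function\<close>

text \<open>A crude Stirling bound. The left side minus the right side decreases when \<open>n\<close> grows by 2,
  so only \<open>n = 1\<close> and \<open>n = 2\<close> have to be checked.\<close>

lemma ln_Gamma_half_integer_bound: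
  assumes "n \<ge> 1"
  shows "ln (Gamma (real n / 2 + 1)) \<le> real n / 2 * ln (real n / 2) - real n / 2 + 1 / 2 * ln (pi * n) + 7 / 6"
proof -
  \<comment> \<open>Since 1/2 ln (pi n) = 1/2 ln (2 pi) + 1/2 ln (n / 2), the claim says that
    \<open>f\<close> at n / 2 is at most 1/2 ln (2 pi) + 7/6.\<close>
  define f where "f x = ln (Gamma (x + 1)) - x * ln x + x - 1 / 2 * ln x" for x :: real
  have step: "f (x + 1) \<le> f x" if "x > 0" for x
  proof -
    have G_pos: "Gamma (x + 1) > 0" using that by (intro Gamma_real_pos) auto
    have "Gamma (x + 1 + 1) = (x + 1) * Gamma (x + 1)"
      using that by (intro Gamma_plus1) (auto dest: nonpos_Ints_nonpos)
    then have G: "ln (Gamma (x + 1 + 1)) = ln (x + 1) + ln (Gamma (x + 1))"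
      using that G_pos by (simp only: ln_mult_pos)
    \<comment> \<open>The left side is 1 / t at the midpoint of [x, x + 1], by convexity at most its
      mean there. It makes f (x + 1) - f x = 1 - (x + 1/2) (ln (x + 1) - ln x) nonpositive.\<close>
    have "2 * 1 / (2 * x + 1) \<le> ln (x + 1) - ln x"
      using ln_inverse_approx_ge[of x "x + 1"] that by (simp add: add.commute add.left_commute)
    then have "(x + 1 / 2) * (2 * 1 / (2 * x + 1)) \<le> (x + 1 / 2) * (ln (x + 1) - ln x)"
      using that by (intro mult_left_mono) auto
    also have "(x + 1 / 2) * (2 * 1 / (2 * x + 1)) = 1" using that by (simp add: field_simps)
    finally have "1 \<le> (x + 1 / 2) * (ln (x + 1) - ln x)" .
    then show ?thesis unfolding f_def G by (simp add: algebra_simps)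
  qed
  have f1: "f (1 / 2) = 1 / 2 * ln pi + 1 / 2"
  proof -
    have "(1 / 2 :: real) \<notin> \<int>\<^sub>\<le>\<^sub>0" using nonpos_Ints_nonpos[of "1 / 2 :: real"] by auto
    then have G: "Gamma (3 / 2 :: real) = sqrt pi / 2"
      using Gamma_plus1[of "1 / 2 :: real"] by (simp add: Gamma_one_half_real)
    then show ?thesis by (simp add: f_def G ln_div ln_sqrt)
  qed
  have f2: "f 1 = 1" using Gamma_fact[of 1, where 'a = real] by (simp add: f_def)
  have "f (real n / 2) \<le> 1 / 2 * ln (2 * pi) + 7 / 6"
    using assms
  proof (induction n rule: less_induct)
    case (less n)
    consider "n = 1" | "n = 2" | "n \<ge> 3" using less.prems by linarith
    then show ?case
    proof cases
      case 1
      then show ?thesis using f1 by (simp add: ln_mult add_divide_distrib add_increasing)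
    next
      case 2
      have "0 \<le> ln (2 * pi)" using pi_ge_two by (intro ln_ge_zero) auto
      then have "1 \<le> 1 / 2 * ln (2 * pi) + 7 / 6" by linarith
      then show ?thesis using 2 f2 by simp
    next
      case 3
      have "f (real (n - 2) / 2 + 1) \<le> f (real (n - 2) / 2)" using 3 by (intro step) auto
      also have "\<dots> \<le> 1 / 2 * ln (2 * pi) + 7 / 6" using 3 by (intro less.IH) auto
      also have "real (n - 2) / 2 + 1 = real n / 2" using 3 by (simp add: of_nat_diff field_simps)
      finally show ?thesis .
    qed
  qed
  then show ?thesis using assms by (simp add: f_def ln_mult ln_div algebra_simps)
qed

lemma integral_exp_minus_lower_bound:
  fixes \<phi> :: "'a::euclidean_space \<Rightarrow> real"
  assumes int: "integrable lborel (\<lambda>x. exp (- \<phi> x))" and "r > 0"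
    and ball: "\<And>x. norm (x - z) \<le> r \<Longrightarrow> \<phi> x \<le> c"
  shows "exp (- c) * (unit_ball_vol (DIM('a)) * r ^ DIM('a)) \<le> (\<integral>x. exp (- \<phi> x) \<partial>lborel)"
proof -
  have "exp (- c) * (unit_ball_vol (DIM('a)) * r ^ DIM('a)) = (\<integral>x. exp (- c) * indicator (cball z r) x \<partial>lborel)"
    using \<open>r > 0\<close> by (simp add: content_cball)
  also have "\<dots> \<le> (\<integral>x. exp (- \<phi> x) \<partial>lborel)"
  proof (rule integral_mono)
    show "integrable lborel (\<lambda>x. exp (- c) * indicator (cball z r) x :: real)"
      by (intro integrable_mult_right integrable_real_indicator) (auto simp: emeasure_cball \<open>r > 0\<close> less_imp_le)
    show "exp (- c) * indicator (cball z r) x \<le> exp (- \<phi> x)" for x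
      using ball[of x] by (auto simp: indicator_def dist_norm norm_minus_commute)
  qed (rule int)
  finally show ?thesis .
qed

text \<open>Gibbs' inequality against the centred Gaussian with covariance \<open>S / DIM('a)\<close> times the identity.\<close>

lemma gibbs_entropy_bound:
  fixes \<phi> :: "'a::euclidean_space \<Rightarrow> real"
  assumes int: "integrable lborel (\<lambda>x. exp (- \<phi> x))" "integrable lborel (\<lambda>x. \<phi> x * exp (- \<phi> x))"
      "integrable lborel (\<lambda>x. (norm x)\<^sup>2 * exp (- \<phi> x))"
    and Z: "Z = (\<integral>x. exp (- \<phi> x) \<partial>lborel)" "Z > 0"
    and S: "(\<integral>x. (norm x)\<^sup>2 * exp (- \<phi> x) \<partial>lborel) \<le> S * Z" "S > 0"
  shows "(\<integral>x. \<phi> x * exp (- \<phi> x) \<partial>lborel) / Z + ln Z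
    \<le> DIM('a) / 2 * ln (2 * pi * S / DIM('a)) + DIM('a) / 2"
proof -
  define n where "n = real DIM('a)"
  have "n > 0" by (simp add: n_def)
  \<comment> \<open>The exponent of the centred Gaussian with second moment \<open>S\<close>, so
    that \<open>c * S\<close> is n / 2.\<close>
  define c where "c = n / (2 * S)"
  have "c > 0" using \<open>n > 0\<close> \<open>S > 0\<close> by (simp add: c_def)
  define V where "V = (pi / c) powr (n / 2)"
  have "V > 0" using \<open>c > 0\<close> by (simp add: V_def)
  let ?E = "\<lambda>x. exp (- \<phi> x)" and ?G = "\<lambda>x::'a. exp (- c * (norm x)\<^sup>2)"
  have intG: "integrable lborel ?G" using integral_gaussian_euclidean(1)[OF \<open>c > 0\<close>] .
  have "(\<integral>x. \<phi> x * ?E x + (ln Z - ln V) * ?E x - c * ((norm x)\<^sup>2 * ?E x) \<partial>lborel)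
      \<le> (\<integral>x. Z / V * ?G x - ?E x \<partial>lborel)"
  proof (rule integral_mono)
    fix x :: 'a
    \<comment> \<open>The Gaussian density divided by the Gibbs density. Integrating ln t \<le> t -
      1 against \<open>?E\<close> makes the right side vanish, since both densities have mass
      1.\<close>
    define t where "t = Z / V * ?G x / ?E x"
    have "t > 0" using Z \<open>V > 0\<close> by (simp add: t_def)
    have "?E x * ln t \<le> ?E x * (t - 1)" using ln_le_minus_one[OF \<open>t > 0\<close>] by simp
    also have "ln t = ln Z - ln V - c * (norm x)\<^sup>2 + \<phi> x"
      using Z \<open>V > 0\<close> by (simp add: t_def ln_mult ln_div)
    also have "?E x * (t - 1) = Z / V * ?G x - ?E x" by (simp add: t_def algebra_simps)
    finally show "\<phi> x * ?E x + (ln Z - ln V) * ?E x - c * ((norm x)\<^sup>2 * ?E x) \<le> Z / V * ?G x - ?E x"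
      by (simp add: algebra_simps)
  qed (intro Bochner_Integration.integrable_add Bochner_Integration.integrable_diff integrable_mult_right int intG)+
  also have "\<dots> = Z / V * V - Z"
    using integral_gaussian_euclidean(2)[OF \<open>c > 0\<close>, where 'a = 'a] int(1) intG
    by (simp add: Z(1) V_def n_def)
  also have "\<dots> = 0" using \<open>V > 0\<close> by simp
  also have "(\<integral>x. \<phi> x * ?E x + (ln Z - ln V) * ?E x - c * ((norm x)\<^sup>2 * ?E x) \<partial>lborel) =
      (\<integral>x. \<phi> x * ?E x \<partial>lborel) + (ln Z - ln V) * Z - c * (\<integral>x. (norm x)\<^sup>2 * ?E x \<partial>lborel)"
    using int by (simp add: Z(1))
  finally have "(\<integral>x. \<phi> x * ?E x \<partial>lborel) + (ln Z - ln V) * Z \<le> c * (\<integral>x. (norm x)\<^sup>2 * ?E x \<partial>lborel)"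
    by simp
  also have "\<dots> \<le> c * (S * Z)" using S(1) \<open>c > 0\<close> by (intro mult_left_mono) auto
  also have "c * (S * Z) = n / 2 * Z" using \<open>S > 0\<close> by (simp add: c_def)
  finally have "(\<integral>x. \<phi> x * ?E x \<partial>lborel) / Z + ln Z \<le> ln V + n / 2"
    using Z(2) by (simp add: field_simps)
  also have "ln V = n / 2 * ln (2 * pi * S / n)"
    using \<open>c > 0\<close> by (simp add: V_def c_def ln_powr mult_ac)
  finally show ?thesis by (simp add: n_def)
qed

section \<open>The Gibbs measure as a normalised density\<close>

lemma gibbs_eq_density:
  fixes u :: "'a::euclidean_space \<Rightarrow> real"
  assumes int: "integrable lborel (\<lambda>x. exp (- \<beta> * u x))"
    and Z: "Z = (\<integral>x. exp (- \<beta> * u x) \<partial>lborel)" "Z > 0"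
  shows "gibbs \<beta> u = density lborel (\<lambda>x. ennreal (exp (- \<beta> * u x) / Z))"
proof -
  have "(\<integral>\<^sup>+y. ennreal (exp (- \<beta> * u y)) \<partial>lborel) = ennreal Z"
    unfolding Z(1) using int by (rule nn_integral_eq_integral) simp
  then show ?thesis using Z(2) by (simp add: gibbs_def divide_ennreal)
qed

lemma
  fixes u f :: "'a::euclidean_space \<Rightarrow> real"
  assumes int: "integrable lborel (\<lambda>x. exp (- \<beta> * u x))"
    and Z: "Z = (\<integral>x. exp (- \<beta> * u x) \<partial>lborel)" "Z > 0"
    and [measurable]: "u \<in> borel_measurable borel" "f \<in> borel_measurable borel"
  shows integrable_gibbs_iff: "integrable (gibbs \<beta> u) f \<longleftrightarrow> integrable lborel (\<lambda>x. f x * exp (- \<beta> * u x))"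
    and integral_gibbs: "(\<integral>x. f x \<partial>gibbs \<beta> u) = (\<integral>x. f x * exp (- \<beta> * u x) \<partial>lborel) / Z"
proof -
  have "integrable (gibbs \<beta> u) f \<longleftrightarrow> integrable lborel (\<lambda>x. (f x * exp (- \<beta> * u x)) / Z)"
    unfolding gibbs_eq_density[OF int Z] using Z(2)
    by (subst integrable_density) (auto simp: mult.commute)
  also have "\<dots> \<longleftrightarrow> integrable lborel (\<lambda>x. f x * exp (- \<beta> * u x))"
    using Z(2) integrable_mult_right_iff[of lborel "\<lambda>x. f x * exp (- \<beta> * u x)" "1 / Z"] by simp
  finally show "integrable (gibbs \<beta> u) f \<longleftrightarrow> integrable lborel (\<lambda>x. f x * exp (- \<beta> * u x))" .
  have "(\<integral>x. f x \<partial>gibbs \<beta> u) = (\<integral>x. (f x * exp (- \<beta> * u x)) / Z \<partial>lborel)"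
    unfolding gibbs_eq_density[OF int Z] using Z(2)
    by (subst integral_density) (auto simp: mult.commute)
  then show "(\<integral>x. f x \<partial>gibbs \<beta> u) = (\<integral>x. f x * exp (- \<beta> * u x) \<partial>lborel) / Z" by simp
qed

lemma prob_space_gibbs:
  fixes u :: "'a::euclidean_space \<Rightarrow> real"
  assumes int: "integrable lborel (\<lambda>x. exp (- \<beta> * u x))"
    and Z: "Z = (\<integral>x. exp (- \<beta> * u x) \<partial>lborel)" "Z > 0"
    and [measurable]: "u \<in> borel_measurable borel"
  shows "prob_space (gibbs \<beta> u)"
proof
  have "emeasure (gibbs \<beta> u) (space (gibbs \<beta> u)) = (\<integral>\<^sup>+x. ennreal (exp (- \<beta> * u x) / Z) \<partial>lborel)"
    unfolding gibbs_eq_density[OF int Z] by (subst emeasure_density) auto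
  also have "\<dots> = ennreal ((\<integral>x. exp (- \<beta> * u x) / Z \<partial>lborel))"
    using int Z(2) by (intro nn_integral_eq_integral) auto
  also have "\<dots> = 1" using Z by simp
  finally show "emeasure (gibbs \<beta> u) (space (gibbs \<beta> u)) = 1" .
qed

lemma sets_gibbs [simp]: "sets (gibbs \<beta> u) = sets borel"
  by (simp add: gibbs_def)

section \<open>Excess risk\<close>

lemma is_selection_scale:
  assumes "is_selection L u h" "\<beta> \<ge> 0"
  shows "is_selection (\<beta> * L) (\<lambda>x. \<beta> * u x) (\<lambda>x. \<beta> *\<^sub>R h x)"
  unfolding is_selection_def subdifferential_def
proof (intro allI CollectI)
  fix x y
  show "\<beta> * u x + (\<beta> *\<^sub>R h x) \<bullet> (y - x) - \<beta> * L / 2 * (norm (y - x))\<^sup>2 \<le> \<beta> * u y"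
    using mult_left_mono[OF is_selectionD[OF assms(1), of x y] assms(2)] by (simp add: algebra_simps)
qed

text \<open>Lets a property of all selections be used at a chosen subgradient. It is applied with 0
  at the minimiser, where \<open>h\<close> itself may be nonzero.\<close>

lemma is_selection_update:
  assumes "is_selection L u h" "g \<in> subdifferential L u z"
  shows "is_selection L u (h(z := g))"
  using assms by (simp add: is_selection_def)

lemma zero_in_subdifferential_minimiser:
  assumes "L \<ge> 0" "\<And>x. u z \<le> u x"
  shows "0 \<in> subdifferential L u z"
proof -
  have "u z - L / 2 * (norm (y - z))\<^sup>2 \<le> u y" for y
    using assms(2)[of y] mult_nonneg_nonneg[OF \<open>L \<ge> 0\<close> zero_le_power2[of "norm (y - z)"]] by simp
  then show ?thesis by (simp add: subdifferential_def)
qed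

lemma borel_measurable_semiconvex:
  fixes u :: "'a::euclidean_space \<Rightarrow> real"
  assumes "convex_on UNIV (\<lambda>x. u x + L / 2 * (norm x)\<^sup>2)"
  shows "u \<in> borel_measurable borel"
proof -
  have "continuous_on UNIV (\<lambda>x. u x + L / 2 * (norm x)\<^sup>2)"
    by (rule convex_on_continuous[OF open_UNIV assms])
  then have [measurable]: "(\<lambda>x. u x + L / 2 * (norm x)\<^sup>2) \<in> borel_measurable borel"
    by (rule borel_measurable_continuous_onI)
  have "(\<lambda>x. (u x + L / 2 * (norm x)\<^sup>2) - L / 2 * (norm x)\<^sup>2) \<in> borel_measurable borel"
    by measurable
  then show ?thesis by simp
qed

lemma integrable_of_powr_growth:
  fixes f :: "'a::real_normed_vector \<Rightarrow> real"
  assumes "finite_measure M" "f \<in> borel_measurable M" "integrable M (\<lambda>x. norm x powr k)" "\<And>x. \<bar>f x\<bar> \<le> a * (1 + norm x powr k)"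
  shows "integrable M f"
proof (rule Bochner_Integration.integrable_bound)
  interpret finite_measure M by fact
  show "integrable M (\<lambda>x. a * (1 + norm x powr k))" using assms(3) by simp
  show "AE x in M. norm (f x) \<le> norm (a * (1 + norm x powr k))"
    using assms(4) by (auto intro: order_trans[OF _ abs_ge_self])
qed (fact assms(2))

text \<open>Comparison with the minimiser makes the one-sided increment bound two-sided. The highest
  power of the norm is p + 1, at most 2 p, so moments of order 2 p make \<open>u\<close>
  integrable.\<close>

lemma abs_le_of_increment_bound:
  fixes u :: "'a::real_normed_vector \<Rightarrow> real"
  assumes incr: "\<And>x y. u x - u y \<le> norm (x - y) * (m + k * (norm x powr p + norm y powr p))"
    and min: "\<And>x. u z \<le> u x" and "m \<ge> 0" "k \<ge> 0" "p \<ge> 1"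
  shows "\<bar>u x\<bar> \<le> (\<bar>u z\<bar> + (1 + norm z) * (m + k * (1 + norm z powr p))) * (1 + norm x powr (2 * p))"
proof -
  define T where "T = 1 + norm x powr (2 * p)"
  define C where "C = m + k * (1 + norm z powr p)"
  have T: "norm x powr r \<le> T" if "0 \<le> r" "r \<le> 2 * p" for r
    using that powr_le_one_plus_powr[of "norm x" r "2 * p"] by (simp add: T_def)
  have T1: "norm x \<le> T" "1 \<le> T" using T[of 1] \<open>p \<ge> 1\<close> by (auto simp: T_def)
  have Tp: "norm x powr p \<le> T" "norm x * norm x powr p \<le> T"
    using T[of p] T[of "1 + p"] \<open>p \<ge> 1\<close> by (auto simp: powr_add)
  have C: "C \<ge> 0" using assms by (simp add: C_def)
  have "u x - u z \<le> norm (x - z) * (m + k * (norm x powr p + norm z powr p))" by (rule incr)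
  also have "\<dots> \<le> (norm x + norm z) * (m + k * (norm x powr p + norm z powr p))"
    using assms by (intro mult_right_mono norm_triangle_ineq4) auto
  also have "\<dots> = m * norm x + k * (norm x * norm x powr p) + k * norm z powr p * norm x
      + norm z * (m * 1 + k * norm x powr p + k * norm z powr p * 1)"
    by (simp add: algebra_simps)
  also have "\<dots> \<le> m * T + k * T + k * norm z powr p * T + norm z * (m * T + k * T + k * norm z powr p * T)"
    using assms T1 Tp by (intro add_mono mult_left_mono) auto
  also have "\<dots> = (1 + norm z) * C * T" by (simp add: C_def algebra_simps)
  finally have 1: "u x - u z \<le> (1 + norm z) * C * T" .
  have "\<bar>u x\<bar> \<le> \<bar>u z\<bar> * 1 + (u x - u z)" using min[of x] by linarith
  also have "\<dots> \<le> \<bar>u z\<bar> * T + (1 + norm z) * C * T"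
    using 1 T1(2) by (intro add_mono mult_left_mono) auto
  finally show ?thesis by (simp add: T_def C_def algebra_simps)
qed

section \<open>The Gibbs measure of a dissipative potential\<close>

locale dissipative_potential =
  fixes u :: "'a::euclidean_space \<Rightarrow> real" and h :: "'a \<Rightarrow> 'a" and L \<mu> b \<beta> :: real and z :: 'a
  assumes u_measurable [measurable]: "u \<in> borel_measurable borel"
    and sel: "is_selection L u h" "L \<ge> 0"
    and diss: "\<And>x. \<mu> / 2 * (norm x)\<^sup>2 - b \<le> h x \<bullet> x" "\<mu> > 0"
    and \<beta>_pos: "\<beta> > 0"
    and minimal: "\<And>x. u z \<le> u x"
begin

definition Z where "Z = (\<integral>x. exp (- \<beta> * u x) \<partial>lborel)"

lemma b_nonneg: "b \<ge> 0"
  using diss(1)[of 0] by simp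

definition c0 where "c0 = \<beta> * (u z - \<mu> / 8 * (sqrt (4 * b / \<mu>) + 1)\<^sup>2)"

lemma growth: "c0 + \<beta> * \<mu> / 8 * (norm x)\<^sup>2 \<le> \<beta> * u x" "\<beta> * \<mu> / 8 > 0"
proof -
  have "\<beta> * (u z - \<mu> / 8 * (sqrt (4 * b / \<mu>) + 1)\<^sup>2 + \<mu> / 8 * (norm x)\<^sup>2) \<le> \<beta> * u x"
    using \<beta>_pos by (intro mult_left_mono quadratic_growth_of_dissipative[OF sel(1) diss(2) b_nonneg diss(1) minimal]) auto
  then show "c0 + \<beta> * \<mu> / 8 * (norm x)\<^sup>2 \<le> \<beta> * u x" by (simp add: c0_def algebra_simps)
qed (use \<beta>_pos diss(2) in simp)

lemma integrable_powr_exp: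
  assumes "k \<ge> 0"
  shows "integrable lborel (\<lambda>x. norm x powr k * exp (- \<beta> * u x))"
  using integrable_powr_mult_exp[OF _ growth assms] by simp

lemma integrable_exp: "integrable lborel (\<lambda>x. exp (- \<beta> * u x))"
proof (rule Bochner_Integration.integrable_bound)
  show "integrable lborel (\<lambda>x::'a. exp (- c0) * exp (- (\<beta> * \<mu> / 8) * (norm x)\<^sup>2))"
    by (intro integrable_mult_right integral_gaussian_euclidean growth)
  show "AE x in lborel. norm (exp (- \<beta> * u x)) \<le> norm (exp (- c0) * exp (- (\<beta> * \<mu> / 8) * (norm x)\<^sup>2))"
    using growth(1) by (intro AE_I2) (simp add: algebra_simps flip: exp_add)
qed measurable

lemma weighted_moment_bound:
  fixes q :: real
  assumes "q \<ge> 2"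
  shows "(\<integral>x. norm x powr q * exp (- \<beta> * u x) \<partial>lborel) \<le> (2 * (b + (DIM('a) + q - 2) / \<beta>) / \<mu>) powr (q / 2) * Z"
proof -
  have "\<beta> * \<mu> / 2 * (norm x)\<^sup>2 - \<beta> * b \<le> (\<beta> *\<^sub>R h x) \<bullet> x" for x
    using mult_left_mono[OF diss(1)[of x], of \<beta>] \<beta>_pos by (simp add: algebra_simps)
  moreover have "(\<beta> * b + DIM('a) + q - 2) / (\<beta> * \<mu> / 2) = 2 * (b + (DIM('a) + q - 2) / \<beta>) / \<mu>"
    using \<beta>_pos diss(2) by (simp add: field_simps)
  ultimately show ?thesis
    using gibbs_weighted_moment_bound[where \<alpha> = "\<beta> * \<mu> / 2" and b = "\<beta> * b" and q = q,
        OF _ growth is_selection_scale[OF sel(1)]]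
      \<beta>_pos diss(2) sel(2) assms by (simp add: Z_def)
qed

lemma Z_ge:
  assumes "r > 0" "\<And>x. norm (x - z) \<le> r \<Longrightarrow> \<beta> * u x \<le> c"
  shows "exp (- c) * (unit_ball_vol (DIM('a)) * r ^ DIM('a)) \<le> Z"
  using integral_exp_minus_lower_bound[of "\<lambda>x. \<beta> * u x" r z c] assms integrable_exp by (simp add: Z_def)

lemma Z_pos: "Z > 0"
proof -
  have "Z \<ge> 0" by (simp add: Z_def)
  moreover have "Z \<noteq> 0"
  proof
    assume "Z = 0"
    then have "AE x in (lborel :: 'a measure). exp (- \<beta> * u x) = 0"
      using integral_nonneg_eq_0_iff_AE[OF integrable_exp] by (simp add: Z_def)
    then have "AE x in (lborel :: 'a measure). False" by simp
    then have "emeasure (lborel :: 'a measure) UNIV = 0" by (simp add: eventually_False ae_filter_eq_bot_iff)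
    then show False by simp
  qed
  ultimately show ?thesis by simp
qed

lemmas gibbs_facts = prob_space_gibbs[OF integrable_exp Z_def Z_pos u_measurable]
  integrable_gibbs_iff[OF integrable_exp Z_def Z_pos u_measurable]
  integral_gibbs[OF integrable_exp Z_def Z_pos u_measurable]

lemma gibbs_moment_bound:
  fixes q :: real
  assumes "q \<ge> 2"
  shows "(\<integral>x. norm x powr q \<partial>gibbs \<beta> u) \<le> (2 * (b + (DIM('a) + q - 2) / \<beta>) / \<mu>) powr (q / 2)"
  using weighted_moment_bound[OF assms] Z_pos by (simp add: gibbs_facts field_simps)

lemma integrable_gibbs_powr:
  assumes "k \<ge> 0"
  shows "integrable (gibbs \<beta> u) (\<lambda>x. norm x powr k)"
  using integrable_powr_exp[OF assms] by (simp add: gibbs_facts)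

lemma gibbs_excess_bound:
  assumes u: "integrable (gibbs \<beta> u) u"
    and J: "\<And>x. norm (x - z) \<le> 1 \<Longrightarrow> u x - u z \<le> J * norm (x - z)" "J > 0" "1 \<le> \<beta> * J"
  defines "n \<equiv> real DIM('a)"
  shows "(\<integral>x. u x \<partial>gibbs \<beta> u) - u z \<le>
    n / (2 * \<beta>) * ln (2 * (b + n / \<beta>) * \<beta>\<^sup>2 * J\<^sup>2 / \<mu>) + 1 / (2 * \<beta>) * ln (pi * n) + 13 / (6 * \<beta>)"
proof -
  define S where "S = 2 * (b + n / \<beta>) / \<mu>"
  define E where "E = (\<integral>x. u x \<partial>gibbs \<beta> u)"
  define G where "G = Gamma (n / 2 + 1)"
  have n: "n \<ge> 1" using DIM_positive[where 'a = 'a] by (simp add: n_def Suc_le_eq)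
  have "S > 0" using n b_nonneg \<beta>_pos diss(2) by (simp add: S_def add_nonneg_pos)
  have "G > 0" using n by (auto simp: G_def intro!: Gamma_real_pos)
  \<comment> \<open>On this ball \<open>\<beta> * u\<close> rises at most 1 above its minimum, and
    \<open>1 \<le> \<beta> * J\<close> keeps the radius within the unit distance where
    \<open>J\<close> is a valid slope.\<close>
  define r where "r = 1 / (\<beta> * J)"
  have r: "r > 0" "r \<le> 1" using J \<beta>_pos by (auto simp: r_def)
  have Z1: "exp (- (\<beta> * u z + 1)) * (pi powr (n / 2) / G * r powr n) \<le> Z"
  proof -
    have "exp (- (\<beta> * u z + 1)) * (unit_ball_vol n * r ^ DIM('a)) \<le> Z"
      unfolding n_def
    proof (rule Z_ge[OF r(1)])
      fix x assume x: "norm (x - z) \<le> r"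
      then have "u x - u z \<le> J * norm (x - z)" using r J by auto
      also have "\<dots> \<le> J * r" using x J by (intro mult_left_mono) auto
      finally have "\<beta> * (u x - u z) \<le> \<beta> * (J * r)" using \<beta>_pos by (intro mult_left_mono) auto
      also have "\<dots> = 1" using \<beta>_pos J by (simp add: r_def)
      finally show "\<beta> * u x \<le> \<beta> * u z + 1" by (simp add: algebra_simps)
    qed
    then show ?thesis using r by (simp add: unit_ball_vol_def G_def n_def powr_realpow)
  qed
  then have "ln (exp (- (\<beta> * u z + 1)) * (pi powr (n / 2) / G * r powr n)) \<le> ln Z"
    using r \<open>G > 0\<close> Z_pos by (subst ln_le_cancel_iff) auto
  moreover have "ln r = - ln (\<beta> * J)" using \<beta>_pos J by (simp add: r_def ln_div)
  ultimately have lnZ: "- \<beta> * u z - 1 + n / 2 * ln pi - ln G - n * ln (\<beta> * J) \<le> ln Z"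
    using r \<open>G > 0\<close> by (simp add: ln_mult ln_div ln_powr)
  have Eu: "\<beta> * E = (\<integral>x. \<beta> * u x * exp (- (\<beta> * u x)) \<partial>lborel) / Z"
    by (simp add: E_def gibbs_facts mult.assoc)
  have "(\<integral>x. \<beta> * u x * exp (- (\<beta> * u x)) \<partial>lborel) / Z + ln Z \<le> DIM('a) / 2 * ln (2 * pi * S / DIM('a)) + DIM('a) / 2"
  proof (rule gibbs_entropy_bound)
    show "integrable lborel (\<lambda>x. exp (- (\<beta> * u x)))" "Z = (\<integral>x. exp (- (\<beta> * u x)) \<partial>lborel)" "Z > 0"
      using integrable_exp Z_pos by (auto simp: Z_def)
    show "integrable lborel (\<lambda>x. \<beta> * u x * exp (- (\<beta> * u x)))"
      using u by (simp add: gibbs_facts mult.assoc)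
    show "integrable lborel (\<lambda>x. (norm x)\<^sup>2 * exp (- (\<beta> * u x)))"
      using integrable_powr_exp[of 2] by simp
    show "(\<integral>x. (norm x)\<^sup>2 * exp (- (\<beta> * u x)) \<partial>lborel) \<le> S * Z"
    proof -
      have "2 * (b + (real DIM('a) + 2 - 2) / \<beta>) / \<mu> = S" by (simp add: S_def n_def)
      then show ?thesis using weighted_moment_bound[of 2] \<open>S > 0\<close> by simp
    qed
  qed (rule \<open>S > 0\<close>)
  then have "\<beta> * E + ln Z \<le> n / 2 * ln (2 * pi * S / n) + n / 2" by (simp add: Eu n_def)
  \<comment> \<open>Arranged for cancellation: ln pi against the volume of the ball, ln (n / 2)
    against the Stirling bound for \<open>G\<close>, which also removes the n / 2 of the Gaussian
    entropy.\<close>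
  also have "ln (2 * pi * S / n) = ln S + ln pi - ln (n / 2)"
    using \<open>S > 0\<close> n by (simp add: ln_mult ln_div)
  finally have "\<beta> * (E - u z) \<le> n / 2 * (ln S + ln pi - ln (n / 2)) + n / 2 + 1 - n / 2 * ln pi + ln G + n * ln (\<beta> * J)"
    using lnZ by (simp add: algebra_simps)
  also have "ln G \<le> n / 2 * ln (n / 2) - n / 2 + 1 / 2 * ln (pi * n) + 7 / 6"
    using ln_Gamma_half_integer_bound[of "DIM('a)"] n by (simp add: G_def n_def)
  finally have "\<beta> * (E - u z) \<le> n / 2 * (ln S + 2 * ln (\<beta> * J)) + 1 / 2 * ln (pi * n) + 13 / 6"
    by (simp add: algebra_simps add_divide_distrib)
  also have "ln S + 2 * ln (\<beta> * J) = ln (S * (\<beta> * J)\<^sup>2)"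
    using \<open>S > 0\<close> \<beta>_pos J by (simp add: ln_mult ln_realpow)
  also have "S * (\<beta> * J)\<^sup>2 = 2 * (b + n / \<beta>) * \<beta>\<^sup>2 * J\<^sup>2 / \<mu>"
    by (simp add: S_def power_mult_distrib)
  finally show ?thesis unfolding E_def[symmetric]
    using \<beta>_pos by (simp add: field_simps)
qed

end

text \<open>Integrability belongs to the conclusion because the Bochner integral of a nonintegrable
  function is 0 by convention, so the inequality alone would say nothing about an expectation. A
  single family with \<open>\<theta>0\<close> at index 0 encodes the joint independence of the start
  and the noises.\<close>

theorem theorem2:
  fixes u :: "real ^ 'd \<Rightarrow> real"
    and h :: "real ^ 'd \<Rightarrow> real ^ 'd"
    and M :: "'w measure"
    and \<theta>0 :: "'w \<Rightarrow> real ^ 'd"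
    and \<xi> :: "nat \<Rightarrow> 'w \<Rightarrow> real ^ 'd"
    and \<theta>_min :: "real ^ 'd"
    and L \<mu> R m K p b J lam0 d :: real
  assumes d: "d = real CARD('d)"
    and A1: "L \<ge> 0" "convex_on UNIV (\<lambda>x. u x + L / 2 * (norm x)\<^sup>2)"
    and A2: "\<mu> > 0" "R \<ge> 0"
      "\<And>h' x y. is_selection L u h' \<Longrightarrow> norm (x - y) \<ge> R \<Longrightarrow>
         (h' x - h' y) \<bullet> (x - y) \<ge> \<mu> * (norm (x - y))\<^sup>2"
    and A3: "m > 0" "K > 0" "p \<ge> 1"
      "\<And>h' x. is_selection L u h' \<Longrightarrow> norm (h' x) \<le> m + K * norm x powr p"
    and prob: "prob_space M"
    and A4: "\<theta>0 \<in> borel_measurable M" "integrable M (\<lambda>\<omega>. norm (\<theta>0 \<omega>) powr (2 * p))"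
    and gauss: "\<And>k. k \<ge> 1 \<Longrightarrow> distributed M lborel (\<xi> k) (\<lambda>x. ennreal (std_gaussian_density x))"
    and indep: "prob_space.indep_vars M (\<lambda>_. borel) (\<lambda>k. if k = 0 then \<theta>0 else \<xi> k) UNIV"
    and h: "is_selection L u h" "h \<in> borel_measurable borel"
    and lam0: "0 < lam0" "lam0 < 1 / (4 * \<mu>)"
    and minimiser: "\<And>x. u \<theta>_min \<le> u x"
    and b: "b = max (m\<^sup>2 / (2 * \<mu>)) (m * R + (L + \<mu> / 2) * R\<^sup>2)"
    and J: "J = m + K * 2 powr (2 * p - 2) * (1 + (2 * b / \<mu>) powr (p / 2))
                  + K * 2 powr (p - 1) / (p + 1)"
  shows "\<forall>lam n \<beta>. 0 < lam \<and> lam < lam0 \<and> \<beta> \<ge> max (4 / \<mu>) (1 / J) \<longrightarrow>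
    integrable M (\<lambda>\<omega>. u (sg_tula h \<mu> \<beta> lam \<theta>0 \<xi> n \<omega>)) \<and>
    (\<integral>\<omega>. u (sg_tula h \<mu> \<beta> lam \<theta>0 \<xi> n \<omega>) \<partial>M) - u \<theta>_min
      \<le> CT1 (\<integral>\<omega>. norm (\<theta>0 \<omega>) powr (2 * p) \<partial>M) m K p \<mu> b \<beta> d
            * wasserstein2 (gibbs \<beta> u) (distr M borel (sg_tula h \<mu> \<beta> lam \<theta>0 \<xi> n))
        + d / (2 * \<beta>) * ln (2 * (b + d / \<beta>) * \<beta>\<^sup>2 * J\<^sup>2 / \<mu>)
        + 1 / (2 * \<beta>) * ln (pi * d) + 13 / (6 * \<beta>)"
proof (intro allI impI)
  fix lam n \<beta>
  assume A: "0 < lam \<and> lam < lam0 \<and> \<beta> \<ge> max (4 / \<mu>) (1 / J)"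
  then have "0 < 4 / \<mu>" "4 / \<mu> \<le> \<beta>" "1 / J \<le> \<beta>" using A2(1) by auto
  then have \<beta>: "\<beta> > 0" by linarith
  have lam: "0 < lam" "lam < 1 / (4 * \<mu>)" using A lam0 by auto
  interpret prob_space M by (rule prob)
  define k where "k = 2 powr (p - 1) * K / (p + 1)"
  have "k \<ge> 0" using A3 by (simp add: k_def)
  have b_nonneg: "b \<ge> 0" using A2(1) unfolding b by (simp add: le_max_iff_disj)
  have u_meas [measurable]: "u \<in> borel_measurable borel" by (rule borel_measurable_semiconvex[OF A1(2)])
  have dissipative: "\<mu> / 2 * (norm x)\<^sup>2 - b \<le> h' x \<bullet> x" if h': "is_selection L u h'" for h' x
    unfolding b using A2(3)[OF h', of _ 0] A3(4)[OF h', of 0] A3(3)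
    by (intro dissipative_of_strongly_monotone_at_infinity[OF h' A1(1) A2(1,2)]) auto
  have incr: "u x - u y \<le> norm (x - y) * (m + k * (norm x powr p + norm y powr p))" for x y
    unfolding k_def using A3(2) by (intro growth_increment_bound[OF h(1) A1(1) A3(3) _ A3(4)[OF h(1)]]) auto
  have u_bound: "\<exists>a. \<forall>x. \<bar>u x\<bar> \<le> a * (1 + norm x powr (2 * p))"
    using abs_le_of_increment_bound[OF incr minimiser] A3 \<open>k \<ge> 0\<close> by (intro exI allI) auto
  \<comment> \<open>\<open>J\<close> must not involve the position of the minimiser, so its norm is
    bounded by dissipativity of a selection that vanishes there.\<close>
  have "norm \<theta>_min powr p \<le> (2 * b / \<mu>) powr (p / 2)"
  proof -
    have "is_selection L u (h(\<theta>_min := 0))"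
      by (intro is_selection_update h(1) zero_in_subdifferential_minimiser A1(1) minimiser)
    from dissipative[OF this, of \<theta>_min] have "(norm \<theta>_min)\<^sup>2 \<le> 2 * b / \<mu>"
      using A2(1) by (intro norm_minimiser_bound[where g = 0]) auto
    then have "((norm \<theta>_min)\<^sup>2) powr (p / 2) \<le> (2 * b / \<mu>) powr (p / 2)"
      using A3(3) by (intro powr_mono2) auto
    then show ?thesis by (simp add: powr_powr flip: powr_numeral)
  qed
  \<comment> \<open>\<open>J\<close> carries the larger factor 2 powr (2 p - 2) and an additional
    1.\<close>
  then have "K * 2 powr (p - 1) * norm \<theta>_min powr p \<le> K * 2 powr (2 * p - 2) * (1 + (2 * b / \<mu>) powr (p / 2))"
    using A3 by (intro mult_mono) (auto intro: powr_mono)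
  then have J_ge: "m + K * 2 powr (p - 1) * norm \<theta>_min powr p + K * 2 powr (p - 1) / (p + 1) \<le> J"
    unfolding J by simp
  have J_local: "u x - u \<theta>_min \<le> J * norm (x - \<theta>_min)" if "norm (x - \<theta>_min) \<le> 1" for x
  proof -
    have "u x - u \<theta>_min \<le> norm (x - \<theta>_min) *
        (m + K * 2 powr (p - 1) * norm \<theta>_min powr p + K * 2 powr (p - 1) / (p + 1))"
      using A3(2) that by (intro local_increment_bound[OF h(1) A1(1) A3(3) _ A3(4)[OF h(1)]]) auto
    also have "\<dots> \<le> norm (x - \<theta>_min) * J" using J_ge by (intro mult_left_mono) auto
    finally show ?thesis by (simp add: mult.commute)
  qed
  have "J > 0" using A3 unfolding J by (intro add_pos_nonneg) auto
  then have \<beta>J: "1 \<le> \<beta> * J" using \<open>1 / J \<le> \<beta>\<close> by (simp add: field_simps)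

  interpret dissipative_potential u h L \<mu> b \<beta> \<theta>_min
    using u_meas h(1) A1(1) dissipative[OF h(1)] A2(1) \<beta> minimiser by unfold_locales auto
  interpret gibbs: prob_space "gibbs \<beta> u" by (rule gibbs_facts(1))
  define \<theta> where "\<theta> = sg_tula h \<mu> \<beta> lam \<theta>0 \<xi> n"
  define Q where "Q = distr M borel \<theta>"
  have [measurable]: "\<theta> \<in> borel_measurable M"
    unfolding \<theta>_def
  proof (rule measurable_sg_tula[OF h(2) A4(1)])
    fix k :: nat assume "1 \<le> k"
    from gauss[OF this] show "\<xi> k \<in> borel_measurable M" by (simp add: distributed_def)
  qed
  interpret Q: prob_space Q unfolding Q_def by (rule prob_space_distr) simp
  have "integrable M (\<lambda>\<omega>. norm (\<theta> \<omega>) powr (2 * p)) \<and>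
    (\<integral>\<omega>. norm (\<theta> \<omega>) powr (2 * p) \<partial>M) \<le> CB2 (\<integral>\<omega>. norm (\<theta>0 \<omega>) powr (2 * p) \<partial>M) p \<mu> b \<beta> d"
    unfolding \<theta>_def d
    by (rule sg_tula_moment_bound[OF h(2) dissipative[OF h(1)] A2(1) b_nonneg lam \<beta> A3(3) indep gauss A4])
  then have mQ: "integrable Q (\<lambda>x. norm x powr (2 * p))"
    "(\<integral>x. norm x powr (2 * p) \<partial>Q) \<le> CB2 (\<integral>\<omega>. norm (\<theta>0 \<omega>) powr (2 * p) \<partial>M) p \<mu> b \<beta> d"
    by (auto simp: Q_def integrable_distr_eq integral_distr)
  have mP: "integrable (gibbs \<beta> u) (\<lambda>x. norm x powr (2 * p))"
    using A3(3) by (intro integrable_gibbs_powr) auto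
  have mP2: "(\<integral>x. norm x powr (2 * p) \<partial>gibbs \<beta> u) \<le> moment_const \<mu> b \<beta> d (2 * p) powr p"
  proof -
    have "(\<integral>x. norm x powr (2 * p) \<partial>gibbs \<beta> u) \<le> (2 * (b + (d + 2 * p - 2) / \<beta>) / \<mu>) powr p"
      using gibbs_moment_bound[of "2 * p"] A3(3) by (simp add: d)
    \<comment> \<open>For order 2 p, \<open>moment_const\<close> is the base on the left plus
      1.\<close>
    also have "\<dots> \<le> moment_const \<mu> b \<beta> d (2 * p) powr p"
      using A3(3) A2(1) \<beta> b_nonneg by (intro powr_mono2) (auto simp: moment_const_def d add_diff_eq)
    finally show ?thesis .
  qed
  obtain a where a: "\<bar>u x\<bar> \<le> a * (1 + norm x powr (2 * p))" for x using u_bound by blast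
  have uP: "integrable (gibbs \<beta> u) u"
    by (rule integrable_of_powr_growth[OF gibbs.finite_measure_axioms _ mP a]) (simp cong: measurable_cong_sets)
  have uQ: "integrable Q u"
    by (rule integrable_of_powr_growth[OF Q.finite_measure_axioms _ mQ(1) a]) (simp add: Q_def)
  then have u\<theta>: "integrable M (\<lambda>\<omega>. u (\<theta> \<omega>))" "(\<integral>\<omega>. u (\<theta> \<omega>) \<partial>M) = (\<integral>x. u x \<partial>Q)"
    by (auto simp: Q_def integrable_distr_eq integral_distr)
  have "(\<integral>x. u x \<partial>Q) - (\<integral>x. u x \<partial>gibbs \<beta> u) \<le>
    (m + k * (sqrt (CB2 (\<integral>\<omega>. norm (\<theta>0 \<omega>) powr (2 * p) \<partial>M) p \<mu> b \<beta> d)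
      + sqrt (moment_const \<mu> b \<beta> d (2 * p) powr p))) * wasserstein2 (gibbs \<beta> u) Q"
    by (rule expectation_difference_le_wasserstein2[where p = p])
       (use incr A3 \<open>k \<ge> 0\<close> uP uQ mP mP2 mQ gibbs.prob_space_axioms Q.prob_space_axioms in \<open>auto simp: Q_def\<close>)
  also have "sqrt (moment_const \<mu> b \<beta> d (2 * p) powr p) = moment_const \<mu> b \<beta> d (2 * p) powr (p / 2)"
    by (simp add: powr_powr flip: powr_half_sqrt)
  also have "m + k * (sqrt (CB2 (\<integral>\<omega>. norm (\<theta>0 \<omega>) powr (2 * p) \<partial>M) p \<mu> b \<beta> d)
      + moment_const \<mu> b \<beta> d (2 * p) powr (p / 2)) = CT1 (\<integral>\<omega>. norm (\<theta>0 \<omega>) powr (2 * p) \<partial>M) m K p \<mu> b \<beta> d"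
    by (simp add: CT1_def k_def)
  finally have T1: "(\<integral>x. u x \<partial>Q) - (\<integral>x. u x \<partial>gibbs \<beta> u) \<le>
    CT1 (\<integral>\<omega>. norm (\<theta>0 \<omega>) powr (2 * p) \<partial>M) m K p \<mu> b \<beta> d * wasserstein2 (gibbs \<beta> u) Q" .
  have T2: "(\<integral>x. u x \<partial>gibbs \<beta> u) - u \<theta>_min \<le>
    d / (2 * \<beta>) * ln (2 * (b + d / \<beta>) * \<beta>\<^sup>2 * J\<^sup>2 / \<mu>) + 1 / (2 * \<beta>) * ln (pi * d) + 13 / (6 * \<beta>)"
    using gibbs_excess_bound[OF uP J_local \<open>J > 0\<close> \<beta>J] by (simp add: d)
  show "integrable M (\<lambda>\<omega>. u (sg_tula h \<mu> \<beta> lam \<theta>0 \<xi> n \<omega>)) \<and>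
    (\<integral>\<omega>. u (sg_tula h \<mu> \<beta> lam \<theta>0 \<xi> n \<omega>) \<partial>M) - u \<theta>_min
      \<le> CT1 (\<integral>\<omega>. norm (\<theta>0 \<omega>) powr (2 * p) \<partial>M) m K p \<mu> b \<beta> d
            * wasserstein2 (gibbs \<beta> u) (distr M borel (sg_tula h \<mu> \<beta> lam \<theta>0 \<xi> n))
        + d / (2 * \<beta>) * ln (2 * (b + d / \<beta>) * \<beta>\<^sup>2 * J\<^sup>2 / \<mu>)
        + 1 / (2 * \<beta>) * ln (pi * d) + 13 / (6 * \<beta>)"
    using u\<theta> T1 T2 unfolding Q_def \<theta>_def by simp
qed

end
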